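(* Let $K$ be a field, $S=K[t_1,\dots,t_s]$, and let $(0)\neq I\subset S$ be an unmixed graded ideal whose associated primes are generated by linear forms and such that there exists $h\in S_1$ regular on $S/I$. If $\dim(S/I)=1$, then $$\delta_I(d)\le \deg(S/I)-H_I(d)+1\quad\text{for all } d\ge1,$$ or equivalently $H_I(d)-1\le \mathrm{hyp}_I(d)$ for all $d\ge1$.
   Context: $S=\bigoplus_{d\ge0}S_d$ has the standard grading; $K$ is arbitrary. An ideal is unmixed if it is proper and all its associated primes have the same height. $H_I(d)=\dim_K(S_d/I_d)$. With $k=\dim(S/I)$, $\deg(S/I)=(k-1)!\lim_{d\to\infty}H_I(d)/d^{k-1}$ if $k\ge1$ and $\dim_K(S/I)$ if $k=0$. An element $h$ is regular on $S/I$ if $(I:h)=I$. For $d\ge1$ let $\mathcal F_d$ be the set of $f\in S_d\setminus I$ with $(I:f)\ne I$. Put $\mathrm{hyp}_I(d)=\max\{\deg(S/(I,f)): f\in\mathcal F_d\}$ if $\mathcal F_d\ne\emptyset$ and $\mathrm{hyp}_I(d)=0$ otherwise. The minimum distance function is $\delta_I(d)=\deg(S/I)-\mathrm{hyp}_I(d)$. *)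

theory Defs
  imports
    Complex_Main
    "HOL-Algebra.Algebra"
    "HOL-Algebra.Algebraic_Closure_Type"
    "HOL-Library.Poly_Mapping"
    "HOL-Library.Extended_Nat"
begin

section \<open>Notions for commutative rings\<close>

definition prime_chain :: "('a, 'b) ring_scheme \<Rightarrow> nat \<Rightarrow> (nat \<Rightarrow> 'a set) \<Rightarrow> bool" where
  "prime_chain R n P \<longleftrightarrow> (\<forall>i\<le>n. primeideal (P i) R) \<and> (\<forall>i<n. P i \<subset> P (Suc i))"

text \<open>The supremum of the empty set is \<open>0\<close>, so the zero ring gets Krull dimension \<open>0\<close>;
  only quotients by proper ideals matter below.\<close>

definition krull_dim :: "('a, 'b) ring_scheme \<Rightarrow> enat" where
  "krull_dim R = Sup {enat n |n. \<exists>P. prime_chain R n P}"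

definition height :: "('a, 'b) ring_scheme \<Rightarrow> 'a set \<Rightarrow> enat" where
  "height R p = Sup {enat n |n. \<exists>P. prime_chain R n P \<and> P n = p}"

definition colon_ideal :: "('a, 'b) ring_scheme \<Rightarrow> 'a set \<Rightarrow> 'a \<Rightarrow> 'a set" where
  "colon_ideal R I f = {x \<in> carrier R. x \<otimes>\<^bsub>R\<^esub> f \<in> I}"

text \<open>Associated primes of \<open>R/I\<close>: the prime annihilators of elements of \<open>R/I\<close>.\<close>

definition assoc_primes :: "('a, 'b) ring_scheme \<Rightarrow> 'a set \<Rightarrow> 'a set set" where
  "assoc_primes R I = {p. primeideal p R \<and> (\<exists>f\<in>carrier R. p = colon_ideal R I f)}"

definition unmixed :: "('a, 'b) ring_scheme \<Rightarrow> 'a set \<Rightarrow> bool" where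
  "unmixed R I \<longleftrightarrow> ideal I R \<and> I \<noteq> carrier R \<and>
     (\<forall>p\<in>assoc_primes R I. \<forall>q\<in>assoc_primes R I. height R p = height R q)"

definition regular_on_quotient :: "('a, 'b) ring_scheme \<Rightarrow> 'a set \<Rightarrow> 'a \<Rightarrow> bool" where
  "regular_on_quotient R I h \<longleftrightarrow> h \<in> carrier R \<and> colon_ideal R I h = I"


section \<open>The polynomial ring with its standard grading\<close>

text \<open>Polynomials over \<open>'k\<close> in the variables \<open>t\<^sub>i\<close>, \<open>i :: 'n\<close>, as finitely supported functions
  from exponent vectors to coefficients, with convolution as multiplication.
  For finite \<open>'n\<close> this is \<open>K[t\<^sub>1,\<dots>,t\<^sub>s]\<close> with \<open>s = CARD('n)\<close>.\<close>

type_synonym ('n, 'k) mvpoly = "('n \<Rightarrow>\<^sub>0 nat) \<Rightarrow>\<^sub>0 'k"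

definition mpoly_ring :: "('n::finite, 'k::field) mvpoly ring" where
  "mpoly_ring = ring_of_type_algebra"

definition homog_part :: "nat \<Rightarrow> ('n::finite, 'k::field) mvpoly set" where
  "homog_part d = {f. \<forall>m\<in>Poly_Mapping.keys f. (\<Sum>i\<in>UNIV. Poly_Mapping.lookup m i) = d}"

definition graded_ideal :: "('n::finite, 'k::field) mvpoly set \<Rightarrow> bool" where
  "graded_ideal I \<longleftrightarrow> (\<exists>G. G \<subseteq> (\<Union>d. homog_part d) \<and> I = Idl\<^bsub>mpoly_ring\<^esub> G)"

definition generated_by_linear_forms :: "('n::finite, 'k::field) mvpoly set \<Rightarrow> bool" where
  "generated_by_linear_forms p \<longleftrightarrow> (\<exists>G. G \<subseteq> homog_part 1 \<and> p = Idl\<^bsub>mpoly_ring\<^esub> G)"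


section \<open>Hilbert function, degree and minimum distance function\<close>

text \<open>Dimension over \<open>K\<close> of the image of \<open>V\<close> in \<open>S/I\<close>, that is, of \<open>V / (V \<inter> I)\<close>.
  The field \<open>K\<close> acts through its copy in \<open>S/I\<close>, the classes of the constants.\<close>

definition quot_dim :: "('n::finite, 'k::field) mvpoly set \<Rightarrow> ('n, 'k) mvpoly set \<Rightarrow> nat" where
  "quot_dim I V =
     ring.dim (mpoly_ring Quot I)
       (range (\<lambda>c. I +>\<^bsub>mpoly_ring\<^esub> Poly_Mapping.single 0 c))
       ((\<lambda>f. I +>\<^bsub>mpoly_ring\<^esub> f) ` V)"

definition hilbert_fun :: "('n::finite, 'k::field) mvpoly set \<Rightarrow> nat \<Rightarrow> nat" where
  "hilbert_fun I d = quot_dim I (homog_part d)"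

definition deg_quot :: "('n::finite, 'k::field) mvpoly set \<Rightarrow> real" where
  "deg_quot I = (let k = the_enat (krull_dim (mpoly_ring Quot I)) in
     if k = 0 then real (quot_dim I UNIV)
     else fact (k - 1) * lim (\<lambda>d. real (hilbert_fun I d) / real d ^ (k - 1)))"

definition zero_div_forms :: "('n::finite, 'k::field) mvpoly set \<Rightarrow> nat \<Rightarrow> ('n, 'k) mvpoly set" where
  "zero_div_forms I d = {f \<in> homog_part d. f \<notin> I \<and> colon_ideal mpoly_ring I f \<noteq> I}"

text \<open>The degrees occurring here are integers bounded by the degree of \<open>S/I\<close> when \<open>I\<close> is unmixed,
  so the maximum is over a finite set.\<close>

definition hyp_fun :: "('n::finite, 'k::field) mvpoly set \<Rightarrow> nat \<Rightarrow> real" where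
  "hyp_fun I d = (if zero_div_forms I d \<noteq> {}
     then Max ((\<lambda>f. deg_quot (Idl\<^bsub>mpoly_ring\<^esub> (I \<union> {f}))) ` zero_div_forms I d)
     else 0)"

definition min_dist_fun :: "('n::finite, 'k::field) mvpoly set \<Rightarrow> nat \<Rightarrow> real" where
  "min_dist_fun I d = deg_quot I - hyp_fun I d"

end

theory Submission imports Defs begin

text \<open>Write \<open>S = K[t\<^sub>1,\<dots>,t\<^sub>s]\<close> and let \<open>h\<close> be a linear form regular on \<open>S/I\<close>. The Artinian algebra
  \<open>A = S/(I, h - 1)\<close> controls all degrees: \<open>S\<^sub>d/I\<^sub>d\<close> embeds into \<open>A\<close>, and for a form \<open>f\<close> the Hilbert
  function of \<open>S/(I, f)\<close> is eventually equal to \<open>dim\<^sub>K A/fA\<close>. Since \<open>dim S/I = 1\<close>, every associated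
  prime is the ideal of a line through the origin, so all residue fields of \<open>A\<close> are equal to \<open>K\<close> and
  \<open>A\<close> has a flag of ideals with one-dimensional quotients. Let \<open>Q\<close> be its member of codimension
  \<open>H\<^sub>I(d) - 1\<close>. As the image of \<open>S\<^sub>d\<close> in \<open>A\<close> has dimension \<open>H\<^sub>I(d)\<close>, it contains a nonzero element of
  \<open>Q\<close>, that is, there is a form \<open>f \<notin> I\<close> of degree \<open>d\<close> with \<open>fA \<subseteq> Q\<close>. It is a zero divisor if
  \<open>Q \<noteq> A\<close>, and \<open>deg S/(I, f) = dim\<^sub>K A/fA \<ge> H\<^sub>I(d) - 1\<close>.\<close>

section \<open>Ideals of rings given by a type class\<close>

text \<open>The field \<open>K\<close> is arbitrary, so a maximal ideal of \<open>A\<close> has no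
  reason to have residue field \<open>K\<close>; this is where the linear generators of the
  associated primes enter. Every prime \<open>P\<close> above \<open>(I, h - 1)\<close> contains an
  associated prime \<open>p\<close> of \<open>I\<close>, every form of degree \<open>d\<close> is a
  scalar multiple of \<open>h ^ d\<close> modulo \<open>p\<close>, and \<open>h\<close> is 1 modulo
  \<open>P\<close>. The same congruence shows that the form found in \<open>Q\<close> is a zero
  divisor: if \<open>f\<close> lies in \<open>P\<close> and equals \<open>c * h ^ d\<close> modulo
  \<open>p\<close>, then \<open>c = 0\<close> and \<open>f\<close> lies in \<open>p\<close>. The
  flag has to consist of ideals, not just of subspaces: only then does a single element
  \<open>f\<close> of \<open>Q\<close> bound all of \<open>fA\<close>. Codimension
  \<open>H - 1\<close> is the largest for which a subspace of \<open>A\<close> is forced to meet a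
  given subspace of dimension \<open>H\<close>; this is the origin of the 1 in the theorem. It makes
  \<open>Q\<close> proper only for \<open>H\<close> at least 2, and for smaller \<open>H\<close> the
  bound to be shown is at most 0. Finite dimension of \<open>A\<close> is obtained together with the
  flag.\<close>

lemma ring_of_type_algebra_simps [simp]:
  "carrier (ring_of_type_algebra :: 'a::comm_ring_1 ring) = UNIV"
  "x \<otimes>\<^bsub>(ring_of_type_algebra :: 'a ring)\<^esub> y = x * y"
  "x \<oplus>\<^bsub>(ring_of_type_algebra :: 'a ring)\<^esub> y = x + y"
  "\<one>\<^bsub>(ring_of_type_algebra :: 'a ring)\<^esub> = 1"
  "\<zero>\<^bsub>(ring_of_type_algebra :: 'a ring)\<^esub> = 0"
  by (simp_all add: ring_of_type_algebra_def)

lemma ring_of_type_algebra_a_inv [simp]: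
  "\<ominus>\<^bsub>(ring_of_type_algebra :: 'a::comm_ring_1 ring)\<^esub> x = - x"
proof -
  interpret cring "ring_of_type_algebra :: 'a ring" by rule
  show ?thesis by (rule minus_equality) simp_all
qed

lemma ideal_ring_of_type_algebra_iff:
  fixes J :: "'a::comm_ring_1 set"
  shows "ideal J ring_of_type_algebra \<longleftrightarrow>
    0 \<in> J \<and> (\<forall>x\<in>J. \<forall>y\<in>J. x + y \<in> J) \<and> (\<forall>x\<in>J. \<forall>r. r * x \<in> J)"
proof
  assume "ideal J ring_of_type_algebra"
  then interpret ideal J "ring_of_type_algebra :: 'a ring" .
  show "0 \<in> J \<and> (\<forall>x\<in>J. \<forall>y\<in>J. x + y \<in> J) \<and> (\<forall>x\<in>J. \<forall>r. r * x \<in> J)"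
    using additive_subgroup.zero_closed[OF additive_subgroup_axioms]
      additive_subgroup.a_closed[OF additive_subgroup_axioms] I_l_closed by simp
next
  assume J: "0 \<in> J \<and> (\<forall>x\<in>J. \<forall>y\<in>J. x + y \<in> J) \<and> (\<forall>x\<in>J. \<forall>r. r * x \<in> J)"
  interpret cring "ring_of_type_algebra :: 'a ring" by rule
  show "ideal J ring_of_type_algebra"
  proof (rule idealI[OF ring_axioms])
    show "subgroup J (add_monoid ring_of_type_algebra)"
    proof (rule add.subgroupI)
      fix a assume "a \<in> J"
      \<comment> \<open>Closure under negation comes from multiplying by \<open>- 1\<close>.\<close>
      with J have "(- 1) * a \<in> J" by blast
      then show "\<ominus>\<^bsub>ring_of_type_algebra\<^esub> a \<in> J" by simp
    qed (use J in auto)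
  qed (use J in \<open>auto simp: mult.commute\<close>)
qed

lemma
  fixes J :: "'a::comm_ring_1 set"
  assumes "ideal J ring_of_type_algebra"
  shows ideal_zero_mem: "0 \<in> J"
    and ideal_add_mem: "x \<in> J \<Longrightarrow> y \<in> J \<Longrightarrow> x + y \<in> J"
    and ideal_mult_mem: "x \<in> J \<Longrightarrow> r * x \<in> J"
    and ideal_mult_mem': "x \<in> J \<Longrightarrow> x * r \<in> J"
    and ideal_uminus_mem: "x \<in> J \<Longrightarrow> - x \<in> J"
    and ideal_diff_mem: "x \<in> J \<Longrightarrow> y \<in> J \<Longrightarrow> x - y \<in> J"
    and ideal_one_mem: "1 \<in> J \<Longrightarrow> J = UNIV"
proof -
  note J = assms[unfolded ideal_ring_of_type_algebra_iff]
  show "0 \<in> J" and add: "\<And>x y. x \<in> J \<Longrightarrow> y \<in> J \<Longrightarrow> x + y \<in> J"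
    and mult: "\<And>x r. x \<in> J \<Longrightarrow> r * x \<in> J"
    using J by blast+
  show "\<And>x r. x \<in> J \<Longrightarrow> x * r \<in> J"
    using mult by (simp add: mult.commute)
  show minus: "\<And>x. x \<in> J \<Longrightarrow> - x \<in> J"
    using mult[of _ "- 1"] by simp
  show "\<And>x y. x \<in> J \<Longrightarrow> y \<in> J \<Longrightarrow> x - y \<in> J"
    using add minus by (metis add_uminus_conv_diff)
  show "1 \<in> J \<Longrightarrow> J = UNIV"
    using mult by (metis UNIV_eq_I mult_1_right)
qed

lemma ideal_sum_mem:
  fixes J :: "'a::comm_ring_1 set"
  assumes "ideal J ring_of_type_algebra" "\<And>i. i \<in> A \<Longrightarrow> f i \<in> J"
  shows "sum f A \<in> J"
  using assms(2)
  by (induction A rule: infinite_finite_induct)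
    (auto intro: ideal_zero_mem[OF assms(1)] ideal_add_mem[OF assms(1)])

lemma primeideal_ring_of_type_algebra_iff:
  fixes P :: "'a::comm_ring_1 set"
  shows "primeideal P ring_of_type_algebra \<longleftrightarrow>
    ideal P ring_of_type_algebra \<and> 1 \<notin> P \<and> (\<forall>a b. a * b \<in> P \<longrightarrow> a \<in> P \<or> b \<in> P)"
proof
  assume "primeideal P ring_of_type_algebra"
  then interpret primeideal P "ring_of_type_algebra :: 'a ring" .
  show "ideal P ring_of_type_algebra \<and> 1 \<notin> P \<and> (\<forall>a b. a * b \<in> P \<longrightarrow> a \<in> P \<or> b \<in> P)"
    using I_prime I_notcarr ideal_axioms ideal_one_mem[OF ideal_axioms] by auto
next
  assume P: "ideal P ring_of_type_algebra \<and> 1 \<notin> P \<and> (\<forall>a b. a * b \<in> P \<longrightarrow> a \<in> P \<or> b \<in> P)"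
  interpret cring "ring_of_type_algebra :: 'a ring" by rule
  show "primeideal P ring_of_type_algebra"
    by (rule primeidealI) (use P is_cring in auto)
qed

lemma colon_ideal_ring_of_type_algebra:
  fixes J :: "'a::comm_ring_1 set"
  shows "colon_ideal ring_of_type_algebra J f = {x. x * f \<in> J}"
  by (simp add: colon_ideal_def)

lemma ideal_colon:
  fixes J :: "'a::comm_ring_1 set"
  assumes "ideal J ring_of_type_algebra"
  shows "ideal {x. x * f \<in> J} ring_of_type_algebra"
  using assms by (simp add: ideal_ring_of_type_algebra_iff distrib_right mult.assoc)

lemma ideal_add_multiples:
  fixes J :: "'a::comm_ring_1 set"
  assumes J: "ideal J ring_of_type_algebra"
  shows "ideal {a + f * y |a y. a \<in> J} ring_of_type_algebra"
  unfolding ideal_ring_of_type_algebra_iff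
proof (intro conjI ballI allI)
  show "0 \<in> {a + f * y |a y. a \<in> J}"
    using ideal_zero_mem[OF J] by (intro CollectI exI[of _ 0]) simp
next
  fix x y assume "x \<in> {a + f * y |a y. a \<in> J}" "y \<in> {a + f * y |a y. a \<in> J}"
  then obtain a b u v where "x = a + f * u" "y = b + f * v" "a \<in> J" "b \<in> J" by blast
  then have "x + y = (a + b) + f * (u + v)" "a + b \<in> J"
    by (simp_all add: algebra_simps ideal_add_mem[OF J])
  then show "x + y \<in> {a + f * y |a y. a \<in> J}" by blast
next
  fix x r assume "x \<in> {a + f * y |a y. a \<in> J}"
  then obtain a u where "x = a + f * u" "a \<in> J" by blast
  then have "r * x = r * a + f * (r * u)" "r * a \<in> J"
    using ideal_mult_mem[OF J] by (simp_all add: distrib_left mult.left_commute)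
  then show "r * x \<in> {a + f * y |a y. a \<in> J}" by blast
qed

lemma genideal_insert:
  fixes J :: "'a::comm_ring_1 set"
  assumes J: "ideal J ring_of_type_algebra"
  shows "Idl\<^bsub>ring_of_type_algebra\<^esub> (J \<union> {f}) = {a + f * y |a y. a \<in> J}"
proof -
  interpret cring "ring_of_type_algebra :: 'a ring" by rule
  show ?thesis
  proof
    have "J \<union> {f} \<subseteq> {a + f * y |a y. a \<in> J}"
    proof
      fix x assume "x \<in> J \<union> {f}"
      then have "x \<in> J \<and> x = x + f * 0 \<or> x = 0 + f * 1" by auto
      then show "x \<in> {a + f * y |a y. a \<in> J}" using ideal_zero_mem[OF J] by blast
    qed
    then show "Idl\<^bsub>ring_of_type_algebra\<^esub> (J \<union> {f}) \<subseteq> {a + f * y |a y. a \<in> J}"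
      by (rule genideal_minimal[OF ideal_add_multiples[OF J]])
  next
    have I: "ideal (Idl\<^bsub>ring_of_type_algebra\<^esub> (J \<union> {f})) ring_of_type_algebra"
      by (rule genideal_ideal) simp
    have "J \<union> {f} \<subseteq> Idl\<^bsub>ring_of_type_algebra\<^esub> (J \<union> {f})"
      by (rule genideal_self) simp
    then show "{a + f * y |a y. a \<in> J} \<subseteq> Idl\<^bsub>ring_of_type_algebra\<^esub> (J \<union> {f})"
      using ideal_add_mem[OF I] ideal_mult_mem'[OF I] by blast
  qed
qed

text \<open>For \<open>T = {1}\<close> this produces associated primes above an annihilator; for the
  complement of a prime \<open>P \<supseteq> J\<close> it produces an associated prime of \<open>J\<close> inside \<open>P\<close>.\<close>

lemma exists_prime_colon_disjoint:
  fixes J :: "'a::comm_ring_1 set"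
  assumes wf: "wf {(J', J :: 'a set). ideal J ring_of_type_algebra \<and>
      ideal J' ring_of_type_algebra \<and> J \<subset> J'}"
    and J: "ideal J ring_of_type_algebra"
    and T1: "1 \<in> T" and Tm: "\<And>a b. a \<in> T \<Longrightarrow> b \<in> T \<Longrightarrow> a * b \<in> T"
    and x: "{z. z * x \<in> J} \<inter> T = {}"
  shows "\<exists>y. primeideal {z. z * (y * x) \<in> J} ring_of_type_algebra \<and> {z. z * (y * x) \<in> J} \<inter> T = {}"
proof -
  define C where "C y = {z. z * (y * x) \<in> J}" for y
  have idC: "ideal (C y) ring_of_type_algebra" for y
    unfolding C_def by (rule ideal_colon[OF J])
  \<comment> \<open>The relation reverses inclusion, so a minimal element of this family is a
    maximal colon ideal avoiding \<open>T\<close>.\<close>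
  have "C 1 \<in> {C y |y. C y \<inter> T = {}}" using x by (intro CollectI exI[of _ 1]) (simp add: C_def)
  from wfE_min[OF wf this] obtain z where z: "z \<in> {C y |y. C y \<inter> T = {}}"
    and "\<And>y. (y, z) \<in> {(J', J). ideal J ring_of_type_algebra \<and>
      ideal J' ring_of_type_algebra \<and> J \<subset> J'} \<Longrightarrow> y \<notin> {C y |y. C y \<inter> T = {}}" by blast
  then obtain y where y: "C y \<inter> T = {}" and max: "\<And>v. C y \<subset> C v \<Longrightarrow> C v \<inter> T \<noteq> {}"
    using idC by (smt (verit) case_prodI mem_Collect_eq)
  have sub: "C y \<subseteq> C (v * y)" for v
  proof
    fix z assume "z \<in> C y"
    then have "v * (z * (y * x)) \<in> J" by (auto simp: C_def intro: ideal_mult_mem[OF J])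
    then show "z \<in> C (v * y)" by (simp add: C_def ac_simps)
  qed
  have eq: "C (v * y) = C y" if "C (v * y) \<inter> T = {}" for v
    using max[of "v * y"] sub[of v] that by blast
  have eqT: "C (c * y) = C y" if "c \<in> T" for c
  proof (rule eq)
    have "z * c \<in> C y \<inter> T" if "z \<in> C (c * y) \<inter> T" for z
      using that Tm[OF _ \<open>c \<in> T\<close>, of z] by (simp add: C_def ac_simps)
    then show "C (c * y) \<inter> T = {}" using y by blast
  qed
  \<comment> \<open>Either passing from \<open>y\<close> to \<open>b * y\<close> keeps the colon
    ideal off \<open>T\<close>, and maximality puts \<open>a\<close> in it, or some \<open>c\<close>
    in \<open>T\<close> kills \<open>b * y * x\<close> modulo \<open>J\<close>, and
    \<open>eqT\<close> puts \<open>b\<close> in it.\<close>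
  have "a \<in> C y \<or> b \<in> C y" if ab: "a * b \<in> C y" for a b
  proof (cases "C (b * y) \<inter> T = {}")
    case True
    have "a \<in> C (b * y)" using ab by (simp add: C_def ac_simps)
    then show ?thesis using eq[OF True] by simp
  next
    case False
    then obtain c where c: "c \<in> T" "c \<in> C (b * y)" by blast
    then have "b \<in> C (c * y)" by (simp add: C_def ac_simps)
    then show ?thesis using eqT[OF c(1)] by simp
  qed
  then have "primeideal (C y) ring_of_type_algebra"
    using y T1 idC by (auto simp: primeideal_ring_of_type_algebra_iff)
  then show ?thesis using y unfolding C_def by blast
qed

section \<open>Krull dimension of a quotient\<close>

text \<open>The preimage of the image of \<open>P\<close> is \<open>I + P\<close>, which is
  \<open>P\<close> because \<open>I \<subseteq> P\<close>.\<close>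

lemma (in ideal) rcoset_mem_image_iff:
  assumes P: "ideal P R" "I \<subseteq> P" and x: "x \<in> carrier R"
  shows "I +> x \<in> (+>) I ` P \<longleftrightarrow> x \<in> P"
proof
  interpret P: ideal P R by fact
  assume "I +> x \<in> (+>) I ` P"
  then obtain p where p: "p \<in> P" "I +> x = I +> p" by blast
  then have pc: "p \<in> carrier R" using P.Icarr by blast
  have "x \<in> I +> p" using a_rcos_self[OF x] p by simp
  then obtain i where "i \<in> I" "x = i \<oplus> p" by (auto simp: a_r_coset_def')
  then show "x \<in> P" using p P.a_closed P(2) by blast
qed simp

lemma (in ideal) image_rcosets: "(+>) I ` carrier R = carrier (R Quot I)"
  by (auto simp: FactRing_def A_RCOSETS_def')

lemma (in ideal) primeideal_image_quot:
  assumes "cring R" "primeideal P R" "I \<subseteq> P"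
  shows "primeideal ((+>) I ` P) (R Quot I)"
proof (rule primeidealI)
  interpret P: primeideal P R by fact
  note mem = rcoset_mem_image_iff[OF P.ideal_axioms assms(3)]
  show "ideal ((+>) I ` P) (R Quot I)"
    by (rule ring_ideal_imp_quot_ideal[OF ideal_axioms P.ideal_axioms])
  show "cring (R Quot I)" by (rule quotient_is_cring[OF assms(1)])
  show "carrier (R Quot I) \<noteq> (+>) I ` P"
  proof
    assume "carrier (R Quot I) = (+>) I ` P"
    then have "I +> \<one> \<in> (+>) I ` P" using image_rcosets by (metis image_eqI one_closed)
    then have "\<one> \<in> P" using mem[OF one_closed] by simp
    then show False using P.I_notcarr P.one_imp_carrier by simp
  qed
  fix a b assume a: "a \<in> carrier (R Quot I)" and b: "b \<in> carrier (R Quot I)"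
    and ab: "a \<otimes>\<^bsub>R Quot I\<^esub> b \<in> (+>) I ` P"
  from a obtain x where x: "x \<in> carrier R" "a = I +> x"
    unfolding image_rcosets[symmetric] by (elim imageE)
  from b obtain y where y: "y \<in> carrier R" "b = I +> y"
    unfolding image_rcosets[symmetric] by (elim imageE)
  have "I +> (x \<otimes> y) \<in> (+>) I ` P"
    using ab ring_hom_mult[OF rcos_ring_hom x(1) y(1)] x(2) y(2) by simp
  then have "x \<otimes> y \<in> P" using mem[OF m_closed[OF x(1) y(1)]] by simp
  then have "x \<in> P \<or> y \<in> P" by (rule P.I_prime[OF x(1) y(1)])
  then show "a \<in> (+>) I ` P \<or> b \<in> (+>) I ` P" unfolding x(2) y(2) by (elim disjE) auto
qed

lemma (in ideal) prime_chain_vimage_quot: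
  assumes "cring R" and Q: "prime_chain (R Quot I) n Q"
  defines "P \<equiv> \<lambda>i. {r \<in> carrier R. I +> r \<in> Q i}"
  shows "prime_chain R n P \<and> (\<forall>i\<le>n. I \<subseteq> P i)"
  unfolding prime_chain_def
proof (intro conjI allI impI)
  note Q' = Q[unfolded prime_chain_def]
  fix i assume i: "i \<le> n"
  have Qi: "primeideal (Q i) (R Quot I)" using Q' i by simp
  show "primeideal (P i) R"
    unfolding P_def by (rule ring_hom_ring.primeideal_vimage[OF rcos_ring_hom_ring assms(1) Qi])
  show "I \<subseteq> P i"
  proof
    fix a assume a: "a \<in> I"
    have "I +> a = \<zero>\<^bsub>R Quot I\<^esub>" using a_rcos_const[OF a] by (simp add: FactRing_def)
    moreover have "\<zero>\<^bsub>R Quot I\<^esub> \<in> Q i"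
      by (rule additive_subgroup.zero_closed[OF ideal.axioms(1)[OF primeideal.axioms(1)[OF Qi]]])
    ultimately show "a \<in> P i" using a Icarr by (simp add: P_def)
  qed
next
  note Q' = Q[unfolded prime_chain_def]
  fix i assume i: "i < n"
  have Qi: "primeideal (Q (Suc i)) (R Quot I)" using Q' i by (simp add: Suc_leI)
  have sub: "Q i \<subset> Q (Suc i)" using Q' i by simp
  then obtain q where q: "q \<in> Q (Suc i)" "q \<notin> Q i" by blast
  have "q \<in> carrier (R Quot I)" using ideal.Icarr[OF primeideal.axioms(1)[OF Qi] q(1)] .
  then obtain r where "r \<in> carrier R" "q = I +> r"
    unfolding image_rcosets[symmetric] by (elim imageE)
  with q have "r \<in> P (Suc i)" "r \<notin> P i" by (simp_all add: P_def)
  moreover have "P i \<subseteq> P (Suc i)" using sub by (auto simp: P_def)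
  ultimately show "P i \<subset> P (Suc i)" by blast
qed

lemma (in ideal) prime_chain_image_quot:
  assumes "cring R" and P: "prime_chain R n P" "\<forall>i\<le>n. I \<subseteq> P i"
  shows "prime_chain (R Quot I) n (\<lambda>i. (+>) I ` P i)"
  unfolding prime_chain_def
proof (intro conjI allI impI)
  note P' = P[unfolded prime_chain_def]
  fix i assume "i \<le> n"
  then show "primeideal ((+>) I ` P i) (R Quot I)"
    using P' by (intro primeideal_image_quot[OF assms(1)]) simp_all
next
  note P' = P[unfolded prime_chain_def]
  fix i assume i: "i < n"
  have id: "ideal (P i) R" "ideal (P (Suc i)) R"
    using P' i by (simp_all add: Suc_leI primeideal.axioms(1))
  have sub: "P i \<subset> P (Suc i)" using P' i by simp
  then obtain r where r: "r \<in> P (Suc i)" "r \<notin> P i" by blast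
  have "r \<in> carrier R" using r(1) ideal.Icarr[OF id(2)] by simp
  then have "I +> r \<notin> (+>) I ` P i"
    using rcoset_mem_image_iff[OF id(1)] P' i r(2) by simp
  moreover have "P i \<subseteq> P (Suc i)" using sub by blast
  ultimately show "(+>) I ` P i \<subset> (+>) I ` P (Suc i)" using r(1) by blast
qed

text \<open>Preimages and images match the prime chains of \<open>R/I\<close> with those of
  \<open>R\<close> above \<open>I\<close>, so the dimension estimates below need no cosets.\<close>

lemma krull_dim_quot:
  assumes "cring R" "ideal I R"
  shows "krull_dim (R Quot I) = Sup {enat n |n. \<exists>P. prime_chain R n P \<and> (\<forall>i\<le>n. I \<subseteq> P i)}"
proof -
  have "(\<exists>Q. prime_chain (R Quot I) n Q) \<longleftrightarrow> (\<exists>P. prime_chain R n P \<and> (\<forall>i\<le>n. I \<subseteq> P i))" for n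
    using ideal.prime_chain_vimage_quot[OF assms(2,1)] ideal.prime_chain_image_quot[OF assms(2,1)]
    by meson
  then show ?thesis by (simp add: krull_dim_def)
qed

lemma krull_dim_quot_antimono:
  assumes "cring R" "ideal I R" "ideal J R" "I \<subseteq> J"
  shows "krull_dim (R Quot J) \<le> krull_dim (R Quot I)"
  unfolding krull_dim_quot[OF assms(1,2)] krull_dim_quot[OF assms(1,3)]
  by (rule Sup_subset_mono) (use assms(4) in blast)

text \<open>Only the bottom of the chain is compared with \<open>I\<close>, because the chain
  increases.\<close>

lemma krull_dim_quot_ge:
  assumes "cring R" "ideal I R" "prime_chain R n P" "I \<subseteq> P 0"
  shows "enat n \<le> krull_dim (R Quot I)"
proof -
  have "I \<subseteq> P i" if "i \<le> n" for i
    using that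
  proof (induction i)
    case (Suc i)
    then have "P i \<subset> P (Suc i)" using assms(3) by (auto simp: prime_chain_def)
    then show ?case using Suc by auto
  qed (use assms(4) in simp)
  then show ?thesis
    unfolding krull_dim_quot[OF assms(1,2)] using assms(3) by (intro Sup_upper) blast
qed

section \<open>Hilbert's basis theorem\<close>

lemma poly_mapping_sum_singles:
  fixes f :: "'a \<Rightarrow>\<^sub>0 'b::comm_monoid_add"
  shows "f = (\<Sum>m\<in>Poly_Mapping.keys f. Poly_Mapping.single m (Poly_Mapping.lookup f m))"
proof (rule poly_mapping_eqI)
  fix k
  show "Poly_Mapping.lookup f k =
    Poly_Mapping.lookup (\<Sum>m\<in>Poly_Mapping.keys f. Poly_Mapping.single m (Poly_Mapping.lookup f m)) k"
    by (simp add: lookup_sum lookup_single when_def in_keys_iff)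
qed

text \<open>Reduces additive statements about polynomials to monomials; zero is covered as a
  monomial with coefficient 0.\<close>

lemma poly_mapping_single_induct [case_names add single]:
  fixes f :: "'a \<Rightarrow>\<^sub>0 'b::comm_monoid_add"
  assumes "\<And>f g. P f \<Longrightarrow> P g \<Longrightarrow> P (f + g)" and "\<And>m c. P (Poly_Mapping.single m c)"
  shows "P f"
proof -
  have "P (\<Sum>m\<in>A. Poly_Mapping.single m (Poly_Mapping.lookup f m))" if "finite A" for A
    using that
  proof (induction A rule: finite_induct)
    case empty
    then show ?case using assms(2)[of undefined 0] by simp
  qed (simp add: assms)
  from this[of "Poly_Mapping.keys f"] show ?thesis
    unfolding poly_mapping_sum_singles[of f, symmetric] by simp
qed

text \<open>Exponents cancel, so only the term of \<open>f\<close> at \<open>k\<close> contributes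
  at \<open>m + k\<close>.\<close>

lemma lookup_single_times_add:
  fixes f :: "'a::cancel_comm_monoid_add \<Rightarrow>\<^sub>0 'b::comm_ring_1"
  shows "Poly_Mapping.lookup (Poly_Mapping.single m c * f) (m + k) = c * Poly_Mapping.lookup f k"
proof (induction f rule: poly_mapping_single_induct)
  case (add f g)
  then show ?case by (simp add: distrib_left lookup_add)
next
  case (single m' d)
  then show ?case by (simp add: mult_single lookup_single when_def)
qed

section \<open>Dickson's lemma and the lexicographic monomial order\<close>

lemma exists_incseq_subseq:
  fixes f :: "nat \<Rightarrow> nat"
  shows "\<exists>r. strict_mono r \<and> incseq (f \<circ> r)"
proof -
  obtain g :: "nat \<Rightarrow> nat" where g: "strict_mono g" "monoseq (\<lambda>n. f (g n))"
    using seq_monosub by blast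
  show ?thesis
  proof (cases "incseq (\<lambda>n. f (g n))")
    case True
    then show ?thesis using g by (auto simp: o_def)
  next
    case False
    then have dec: "decseq (\<lambda>n. f (g n))" using g(2) monoseq_iff by blast
    \<comment> \<open>A decreasing sequence of naturals is constant from any index where it attains
      its minimum.\<close>
    obtain k where k: "\<And>n. f (g k) \<le> f (g n)"
      using ex_has_least_nat[of "\<lambda>_. True" _ "\<lambda>n. f (g n)"] by blast
    have "f (g (k + n)) = f (g k)" for n
      using k[of "k + n"] decseqD[OF dec, of k "k + n"] by simp
    moreover have "strict_mono (\<lambda>n. g (k + n))"
      using g(1) by (simp add: strict_mono_def)
    ultimately show ?thesis by (intro exI[of _ "\<lambda>n. g (k + n)"]) (simp add: incseq_def)
  qed
qed

text \<open>Passing to a subsequence once per variable makes every exponent nondecreasing; any two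
  members of the last subsequence then work.\<close>

lemma dickson:
  fixes s :: "nat \<Rightarrow> ('n::finite \<Rightarrow>\<^sub>0 nat)"
  obtains i j where "i < j" "\<And>x. Poly_Mapping.lookup (s i) x \<le> Poly_Mapping.lookup (s j) x"
proof -
  have "\<exists>r. strict_mono r \<and> (\<forall>x\<in>A. incseq (\<lambda>k. Poly_Mapping.lookup (s (r k)) x))"
    if "finite A" for A :: "'n set"
    using that
  proof (induction A rule: finite_induct)
    case empty
    then show ?case using strict_mono_id by auto
  next
    case (insert a A)
    then obtain r where r: "strict_mono r"
      "\<And>x. x \<in> A \<Longrightarrow> incseq (\<lambda>k. Poly_Mapping.lookup (s (r k)) x)" by blast
    obtain q :: "nat \<Rightarrow> nat" where q: "strict_mono q"
      "incseq ((\<lambda>k. Poly_Mapping.lookup (s (r k)) a) \<circ> q)"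
      using exists_incseq_subseq by blast
    have "incseq (\<lambda>k. Poly_Mapping.lookup (s (r (q k))) x)" if "x \<in> A" for x
      using r(2)[OF that] q(1) by (simp add: incseq_def strict_mono_less_eq)
    then show ?case using q r(1)
      by (intro exI[of _ "r \<circ> q"]) (auto simp: strict_mono_def o_def)
  qed
  from this[of UNIV] obtain r where r: "strict_mono r"
    "\<And>x. incseq (\<lambda>k. Poly_Mapping.lookup (s (r k)) x)" by auto
  show thesis
  proof (rule that[of "r 0" "r 1"])
    show "r 0 < r 1" using r(1) by (simp add: strict_mono_less)
    show "Poly_Mapping.lookup (s (r 0)) x \<le> Poly_Mapping.lookup (s (r 1)) x" for x
      using incseqD[OF r(2)[of x], of 0 1] by simp
  qed
qed

text \<open>The variable type carries no order, so \<open>to_nat\<close> ranks the variables; the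
  smallest rank decides first.\<close>

definition lex_less :: "('n::finite \<Rightarrow>\<^sub>0 nat) \<Rightarrow> ('n \<Rightarrow>\<^sub>0 nat) \<Rightarrow> bool" where
  "lex_less m m' \<longleftrightarrow> (\<exists>i. Poly_Mapping.lookup m i < Poly_Mapping.lookup m' i \<and>
     (\<forall>j. to_nat j < to_nat i \<longrightarrow> Poly_Mapping.lookup m j = Poly_Mapping.lookup m' j))"

lemma lex_less_irrefl: "\<not> lex_less m m"
  by (simp add: lex_less_def)

lemma lex_less_trans:
  assumes "lex_less a b" "lex_less b c"
  shows "lex_less a c"
proof -
  obtain i where i: "Poly_Mapping.lookup a i < Poly_Mapping.lookup b i"
    "\<And>j. to_nat j < to_nat i \<Longrightarrow> Poly_Mapping.lookup a j = Poly_Mapping.lookup b j"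
    using assms(1) by (auto simp: lex_less_def)
  obtain k where k: "Poly_Mapping.lookup b k < Poly_Mapping.lookup c k"
    "\<And>j. to_nat j < to_nat k \<Longrightarrow> Poly_Mapping.lookup b j = Poly_Mapping.lookup c j"
    using assms(2) by (auto simp: lex_less_def)
  \<comment> \<open>The first place where \<open>a\<close> and \<open>c\<close> differ is the
    earlier of the two given places.\<close>
  define l where "l = (if to_nat i \<le> to_nat k then i else k)"
  have l: "to_nat l \<le> to_nat i" "to_nat l \<le> to_nat k" and "l = i \<or> l = k"
    by (auto simp: l_def)
  have "Poly_Mapping.lookup a j = Poly_Mapping.lookup c j" if "to_nat j < to_nat l" for j
    using i(2)[of j] k(2)[of j] that l by simp
  moreover have "Poly_Mapping.lookup a l < Poly_Mapping.lookup c l"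
  proof (cases "i = k")
    case True
    then show ?thesis using i(1) k(1) \<open>l = i \<or> l = k\<close> by auto
  next
    case False
    then have "to_nat i \<noteq> to_nat k" by simp
    then have "to_nat i < to_nat k \<or> to_nat k < to_nat i" by (rule linorder_neqE_nat) simp_all
    then have "l = i \<and> to_nat l < to_nat k \<or> l = k \<and> to_nat l < to_nat i"
      by (auto simp: l_def)
    then show ?thesis using i k by auto
  qed
  ultimately show ?thesis unfolding lex_less_def by blast
qed

lemma lex_less_linear:
  assumes "a \<noteq> b"
  shows "lex_less a b \<or> lex_less b a"
proof -
  obtain x where x: "Poly_Mapping.lookup a x \<noteq> Poly_Mapping.lookup b x"
    using assms poly_mapping_eqI[of a b] by auto
  obtain i where i: "Poly_Mapping.lookup a i \<noteq> Poly_Mapping.lookup b i"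
    "\<And>j. Poly_Mapping.lookup a j \<noteq> Poly_Mapping.lookup b j \<Longrightarrow> to_nat i \<le> to_nat j"
    using ex_has_least_nat[of "\<lambda>x. Poly_Mapping.lookup a x \<noteq> Poly_Mapping.lookup b x" x to_nat, OF x]
    by auto
  have eq: "Poly_Mapping.lookup a j = Poly_Mapping.lookup b j" if "to_nat j < to_nat i" for j
    using i(2)[of j] that by linarith
  from i(1) consider "Poly_Mapping.lookup a i < Poly_Mapping.lookup b i" |
      "Poly_Mapping.lookup b i < Poly_Mapping.lookup a i"
    by linarith
  then show ?thesis
  proof cases
    case 1
    then have "lex_less a b" unfolding lex_less_def using eq by (intro exI[of _ i]) simp
    then show ?thesis ..
  next
    case 2
    then have "lex_less b a" unfolding lex_less_def using eq by (intro exI[of _ i]) simp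
    then show ?thesis ..
  qed
qed

lemma lex_less_add_left: "lex_less a b \<Longrightarrow> lex_less (c + a) (c + b)"
  by (auto simp: lex_less_def lookup_add)

text \<open>By Dickson's lemma an infinite descent contains \<open>i < j\<close> with
  \<open>s i\<close> below \<open>s j\<close> in every coordinate, which contradicts
  \<open>lex_less (s j) (s i)\<close>.\<close>

lemma wf_lex_less: "wf {(a :: 'n::finite \<Rightarrow>\<^sub>0 nat, b). lex_less a b}"
  unfolding wf_iff_no_infinite_down_chain
proof
  assume "\<exists>s. \<forall>i. (s (Suc i), s i) \<in> {(a :: 'n \<Rightarrow>\<^sub>0 nat, b). lex_less a b}"
  then obtain s :: "nat \<Rightarrow> ('n \<Rightarrow>\<^sub>0 nat)" where s: "\<And>i. lex_less (s (Suc i)) (s i)" by auto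
  have less: "lex_less (s j) (s i)" if "i < j" for i j
    using that
  proof (induction j)
    case (Suc j)
    then show ?case using s[of j] lex_less_trans[OF s[of j]] by (cases "i = j") auto
  qed simp
  obtain i j where ij: "i < j" "\<And>x. Poly_Mapping.lookup (s i) x \<le> Poly_Mapping.lookup (s j) x"
    using dickson[of s] by blast
  obtain x where "Poly_Mapping.lookup (s j) x < Poly_Mapping.lookup (s i) x"
    using less[OF ij(1)] by (auto simp: lex_less_def)
  then show False using ij(2)[of x] by simp
qed

section \<open>Leading monomials and the ascending chain condition\<close>

definition lead_mon :: "(('n::finite \<Rightarrow>\<^sub>0 nat) \<Rightarrow>\<^sub>0 'k::zero) \<Rightarrow> ('n \<Rightarrow>\<^sub>0 nat) \<Rightarrow> bool" where
  "lead_mon f m \<longleftrightarrow> m \<in> Poly_Mapping.keys f \<and> (\<forall>k\<in>Poly_Mapping.keys f. k = m \<or> lex_less k m)"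

lemma exists_lead_mon:
  assumes "f \<noteq> 0"
  shows "\<exists>m. lead_mon f m"
proof -
  have "\<exists>m\<in>Poly_Mapping.keys f. \<forall>x\<in>Poly_Mapping.keys f. x \<noteq> m \<longrightarrow> \<not> lex_less m x"
  proof (rule Finite_Set.bex_max_element)
    show "Poly_Mapping.keys f \<noteq> {}" using assms by simp
    show "asymp_on (Poly_Mapping.keys f) lex_less"
      by (rule asymp_onI) (metis lex_less_irrefl lex_less_trans)
    show "transp_on (Poly_Mapping.keys f) lex_less"
      by (rule transp_onI) (rule lex_less_trans)
  qed simp
  then show ?thesis unfolding lead_mon_def using lex_less_linear by metis
qed

text \<open>In a strict chain take \<open>f i\<close> in \<open>J (Suc i) - J i\<close> with least
  leading monomial \<open>m i\<close>. Dickson's lemma gives \<open>i < j\<close> with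
  \<open>m i\<close> dividing \<open>m j\<close>. Since \<open>f i\<close> already lies in
  \<open>J j\<close>, cancelling the leading term of \<open>f j\<close> by a multiple of
  \<open>f i\<close> stays outside \<open>J j\<close>, against minimality at
  \<open>j\<close>.\<close>

lemma wf_ideal_psupset_mpoly:
  "wf {(J', J :: ('n::finite, 'k::field) mvpoly set). ideal J ring_of_type_algebra \<and>
      ideal J' ring_of_type_algebra \<and> J \<subset> J'}"
  unfolding wf_iff_no_infinite_down_chain
proof
  assume "\<exists>J. \<forall>i. (J (Suc i), J i) \<in> {(J', J :: ('n, 'k) mvpoly set).
    ideal J ring_of_type_algebra \<and> ideal J' ring_of_type_algebra \<and> J \<subset> J'}"
  then obtain J :: "nat \<Rightarrow> ('n, 'k) mvpoly set" where
    "\<forall>i. ideal (J i) ring_of_type_algebra \<and> ideal (J (Suc i)) ring_of_type_algebra \<and> J i \<subset> J (Suc i)"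
    by auto
  then have J: "\<And>i. ideal (J i) ring_of_type_algebra" and strict: "\<And>i. J i \<subset> J (Suc i)"
    by simp_all
  have mono: "J i \<subseteq> J j" if "i \<le> j" for i j
    by (rule lift_Suc_mono_le[where f = J, OF psubset_imp_subset[OF strict] that])
  define minimal where "minimal i f m \<longleftrightarrow> f \<in> J (Suc i) - J i \<and> lead_mon f m \<and>
    (\<forall>g m'. g \<in> J (Suc i) - J i \<and> lead_mon g m' \<longrightarrow> \<not> lex_less m' m)" for i f m
  have "\<exists>f m. minimal i f m" for i
  proof -
    obtain g where g: "g \<in> J (Suc i) - J i" using strict[of i] by blast
    then have "g \<noteq> 0" using ideal_zero_mem[OF J[of i]] by auto
    then obtain k where "lead_mon g k" using exists_lead_mon by blast
    with g have "k \<in> {m. \<exists>f\<in>J (Suc i) - J i. lead_mon f m}" by blast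
    from wfE_min[OF wf_lex_less this] obtain z where z: "z \<in> {m. \<exists>f\<in>J (Suc i) - J i. lead_mon f m}"
      and min: "\<And>y. lex_less y z \<Longrightarrow> y \<notin> {m. \<exists>f\<in>J (Suc i) - J i. lead_mon f m}" by auto
    from z obtain f where "f \<in> J (Suc i) - J i" "lead_mon f z" by blast
    then have "minimal i f z" unfolding minimal_def using min by auto
    then show ?thesis by blast
  qed
  then obtain f m where fm: "\<And>i. minimal i (f i) (m i)" by metis
  have f: "\<And>i. f i \<in> J (Suc i) - J i" and m: "\<And>i. lead_mon (f i) (m i)"
    and min: "\<And>i g m'. g \<in> J (Suc i) - J i \<Longrightarrow> lead_mon g m' \<Longrightarrow> \<not> lex_less m' (m i)"
    using fm unfolding minimal_def by blast+
  obtain i j where ij: "i < j" and le: "\<And>x. Poly_Mapping.lookup (m i) x \<le> Poly_Mapping.lookup (m j) x"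
    using dickson[of m] by blast
  define d where "d = m j - m i"
  have d: "m j = d + m i"
    by (rule poly_mapping_eqI) (simp add: d_def lookup_add lookup_minus le)
  define c where "c = Poly_Mapping.lookup (f j) (m j) / Poly_Mapping.lookup (f i) (m i)"
  define g where "g = f j - Poly_Mapping.single d c * f i"
  have "f i \<in> J j" using f[of i] mono[of "Suc i" j] ij by auto
  then have sub: "Poly_Mapping.single d c * f i \<in> J j" by (rule ideal_mult_mem[OF J])
  then have "Poly_Mapping.single d c * f i \<in> J (Suc j)" using strict[of j] by blast
  then have "g \<in> J (Suc j)"
    unfolding g_def using f[of j] by (intro ideal_diff_mem[OF J]) auto
  moreover have "g \<notin> J j"
  proof
    assume "g \<in> J j"
    then have "g + Poly_Mapping.single d c * f i \<in> J j" using sub by (rule ideal_add_mem[OF J])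
    then show False using f[of j] by (simp add: g_def)
  qed
  ultimately have gJ: "g \<in> J (Suc j) - J j" by blast
  then have "g \<noteq> 0" using ideal_zero_mem[OF J[of j]] by auto
  then obtain k where k: "lead_mon g k" using exists_lead_mon by blast
  have "Poly_Mapping.lookup (f i) (m i) \<noteq> 0" using m[of i] by (simp add: lead_mon_def in_keys_iff)
  then have "Poly_Mapping.lookup g (m j) = 0"
    unfolding g_def lookup_minus using lookup_single_times_add[of d c "f i" "m i"]
    by (simp add: c_def d)
  then have "k \<noteq> m j" using k by (auto simp: lead_mon_def in_keys_iff)
  \<comment> \<open>Every monomial of \<open>g\<close> comes from \<open>f j\<close> or from the
    shifted \<open>f i\<close>, so none exceeds \<open>m j\<close>, and \<open>m j\<close> itself
    has been cancelled.\<close>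
  have "Poly_Mapping.keys g \<subseteq> Poly_Mapping.keys (f j) \<union> Poly_Mapping.keys (Poly_Mapping.single d c * f i)"
    unfolding g_def by (auto simp: in_keys_iff lookup_minus)
  also have "\<dots> \<subseteq> Poly_Mapping.keys (f j) \<union> {d + b |b. b \<in> Poly_Mapping.keys (f i)}"
    using keys_mult[of "Poly_Mapping.single d c" "f i"] by (auto split: if_splits)
  finally have "k \<in> Poly_Mapping.keys (f j) \<or> (\<exists>b\<in>Poly_Mapping.keys (f i). k = d + b)"
    using k by (auto simp: lead_mon_def)
  then have "lex_less k (m j)"
  proof
    assume "k \<in> Poly_Mapping.keys (f j)"
    then show ?thesis using m[of j] \<open>k \<noteq> m j\<close> by (auto simp: lead_mon_def)
  next
    assume "\<exists>b\<in>Poly_Mapping.keys (f i). k = d + b"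
    then obtain b where b: "b \<in> Poly_Mapping.keys (f i)" "k = d + b" by blast
    then have "b \<noteq> m i" using \<open>k \<noteq> m j\<close> d by auto
    then have "lex_less b (m i)" using m[of i] b(1) by (auto simp: lead_mon_def)
    then show ?thesis unfolding b(2) d by (rule lex_less_add_left)
  qed
  then show False using min[OF gJ k] by blast
qed

section \<open>Homogeneous components\<close>

definition mon_deg :: "('n::finite \<Rightarrow>\<^sub>0 nat) \<Rightarrow> nat" where
  "mon_deg m = (\<Sum>i\<in>UNIV. Poly_Mapping.lookup m i)"

lemma mon_deg_0 [simp]: "mon_deg 0 = 0"
  by (simp add: mon_deg_def)

lemma mon_deg_add: "mon_deg (m + m') = mon_deg m + mon_deg m'"
  by (simp add: mon_deg_def lookup_add sum.distrib)

lemma mon_deg_single: "mon_deg (Poly_Mapping.single i k) = k"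
  by (simp add: mon_deg_def lookup_single when_def)

lemma mon_deg_eq_0_iff: "mon_deg m = 0 \<longleftrightarrow> m = 0"
  by (auto simp: mon_deg_def intro: poly_mapping_eqI)

lemma mon_deg_Suc_split:
  assumes "mon_deg m = Suc d"
  shows "\<exists>i m'. m = m' + Poly_Mapping.single i 1 \<and> mon_deg m' = d"
proof -
  have "m \<noteq> 0" using assms mon_deg_eq_0_iff[of m] by auto
  then obtain i where i: "Poly_Mapping.lookup m i \<noteq> 0"
    using poly_mapping_eqI[of m 0] by auto
  define m' where "m' = m - Poly_Mapping.single i 1"
  have m: "m = m' + Poly_Mapping.single i 1"
    using i by (intro poly_mapping_eqI) (auto simp: m'_def lookup_add lookup_minus lookup_single when_def)
  then have "mon_deg m = mon_deg m' + 1" by (simp add: mon_deg_add mon_deg_single)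
  then have "mon_deg m' = d" using assms by simp
  with m show ?thesis by blast
qed

lemma homog_part_iff: "f \<in> homog_part d \<longleftrightarrow> (\<forall>m\<in>Poly_Mapping.keys f. mon_deg m = d)"
  by (simp add: homog_part_def mon_deg_def)

lemma single_in_homog_part: "mon_deg m = d \<Longrightarrow> Poly_Mapping.single m c \<in> homog_part d"
  by (simp add: homog_part_iff)

lemma zero_in_homog_part: "0 \<in> homog_part d"
  by (simp add: homog_part_iff)

lemma homog_part_add: "f \<in> homog_part d \<Longrightarrow> g \<in> homog_part d \<Longrightarrow> f + g \<in> homog_part d"
  using Poly_Mapping.keys_add[of f g] by (auto simp: homog_part_iff)

lemma homog_part_mult:
  assumes "f \<in> homog_part d" "g \<in> homog_part e"
  shows "f * g \<in> homog_part (d + e)"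
  using keys_mult[of f g] assms by (fastforce simp: homog_part_iff mon_deg_add)

lemma const_in_homog_part: "Poly_Mapping.single 0 c \<in> homog_part 0"
  by (rule single_in_homog_part) (simp add: mon_deg_eq_0_iff)

lemma homog_part_scale: "f \<in> homog_part d \<Longrightarrow> Poly_Mapping.single 0 c * f \<in> homog_part d"
  using homog_part_mult[OF const_in_homog_part] by fastforce

lemma homog_part_diff:
  assumes "f \<in> homog_part d" "g \<in> homog_part d"
  shows "f - g \<in> homog_part d"
  using assms by (auto simp: homog_part_iff in_keys_iff lookup_minus)

lemma homog_part_sum: "(\<And>i. i \<in> A \<Longrightarrow> f i \<in> homog_part d) \<Longrightarrow> sum f A \<in> homog_part d"
  by (induction A rule: infinite_finite_induct) (auto intro: zero_in_homog_part homog_part_add)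

lemma homog_part_power: "h \<in> homog_part 1 \<Longrightarrow> h ^ k \<in> homog_part k"
proof (induction k)
  case 0
  then show ?case using const_in_homog_part[of 1] by simp
next
  case (Suc k)
  then show ?case using homog_part_mult[of h 1 "h ^ k" k] by simp
qed

definition homog_comp :: "nat \<Rightarrow> ('n::finite, 'k::field) mvpoly \<Rightarrow> ('n, 'k) mvpoly" where
  "homog_comp n f =
     (\<Sum>m\<in>{m \<in> Poly_Mapping.keys f. mon_deg m = n}. Poly_Mapping.single m (Poly_Mapping.lookup f m))"

lemma lookup_homog_comp:
  "Poly_Mapping.lookup (homog_comp n f) m = (if mon_deg m = n then Poly_Mapping.lookup f m else 0)"
  by (simp add: homog_comp_def lookup_sum lookup_single when_def in_keys_iff)

lemma homog_comp_in_homog_part: "homog_comp n f \<in> homog_part n"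
  by (auto simp: homog_part_iff in_keys_iff lookup_homog_comp split: if_splits)

lemma homog_comp_zero: "homog_comp n 0 = 0"
  by (rule poly_mapping_eqI) (simp add: lookup_homog_comp)

lemma homog_comp_add: "homog_comp n (f + g) = homog_comp n f + homog_comp n g"
  by (rule poly_mapping_eqI) (simp add: lookup_homog_comp lookup_add)

lemma homog_comp_diff: "homog_comp n (f - g) = homog_comp n f - homog_comp n g"
  by (rule poly_mapping_eqI) (simp add: lookup_homog_comp lookup_minus)

lemma homog_comp_of_homog:
  "f \<in> homog_part d \<Longrightarrow> homog_comp n f = (if n = d then f else 0)"
  by (rule poly_mapping_eqI) (auto simp: lookup_homog_comp homog_part_iff in_keys_iff)

text \<open>A factor of degree \<open>d\<close> shifts components by \<open>d\<close>; the case
  distinction guards the truncated \<open>n - d\<close>.\<close>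

lemma homog_comp_homog_mult:
  assumes "g \<in> homog_part d"
  shows "homog_comp n (g * f) = (if d \<le> n then g * homog_comp (n - d) f else 0)"
proof (induction f rule: poly_mapping_single_induct)
  case (add f f')
  then show ?case by (simp add: homog_comp_add distrib_left)
next
  case (single m c)
  have s: "Poly_Mapping.single m c \<in> homog_part (mon_deg m)" by (simp add: single_in_homog_part)
  show ?case
    by (auto simp: homog_comp_of_homog[OF s] homog_comp_of_homog[OF homog_part_mult[OF assms s]])
qed

lemma exists_degree_bound: "\<exists>N. \<forall>k>N. homog_comp k f = 0"
proof -
  \<comment> \<open>The inserted 0 keeps \<open>Max\<close> meaningful for
    \<open>f = 0\<close>.\<close>
  have "homog_comp k f = 0" if "k > Max (insert 0 (mon_deg ` Poly_Mapping.keys f))" for k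
  proof (rule poly_mapping_eqI)
    fix m
    have "mon_deg m \<noteq> k" if "m \<in> Poly_Mapping.keys f"
      using \<open>k > _\<close> that by (auto simp: Max_less_iff)
    then show "Poly_Mapping.lookup (homog_comp k f) m = Poly_Mapping.lookup 0 m"
      by (auto simp: lookup_homog_comp in_keys_iff)
  qed
  then show ?thesis by blast
qed

lemma sum_homog_comp:
  assumes "\<forall>k>N. homog_comp k f = 0"
  shows "f = (\<Sum>k\<le>N. homog_comp k f)"
proof (rule poly_mapping_eqI)
  fix m
  have "Poly_Mapping.lookup f m = 0" if "mon_deg m > N"
    using assms that lookup_homog_comp[of "mon_deg m" f m] by simp
  then show "Poly_Mapping.lookup f m = Poly_Mapping.lookup (\<Sum>k\<le>N. homog_comp k f) m"
    by (auto simp: lookup_sum lookup_homog_comp)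
qed

text \<open>The polynomials with all components in \<open>I\<close> form an ideal that contains the
  homogeneous generators, hence all of \<open>I\<close>.\<close>

lemma homog_comp_graded_ideal:
  assumes "graded_ideal I" "f \<in> I"
  shows "homog_comp n f \<in> I"
proof -
  interpret cring "ring_of_type_algebra :: ('a, 'b) mvpoly ring" by rule
  obtain G where G: "G \<subseteq> (\<Union>d. homog_part d)" "I = Idl\<^bsub>ring_of_type_algebra\<^esub> G"
    using assms(1) by (auto simp: graded_ideal_def mpoly_ring_def)
  have I: "ideal I ring_of_type_algebra"
    unfolding G(2) by (rule genideal_ideal) simp
  have GI: "G \<subseteq> I"
    unfolding G(2) by (rule genideal_self) simp
  define J where "J = {f. \<forall>n. homog_comp n f \<in> I}"
  have mult: "r * f \<in> J" if "f \<in> J" for r f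
  proof (induction r rule: poly_mapping_single_induct)
    case (add r s)
    then show ?case by (simp add: J_def distrib_right homog_comp_add ideal_add_mem[OF I])
  next
    case (single m c)
    have "Poly_Mapping.single m c \<in> homog_part (mon_deg m)" by (simp add: single_in_homog_part)
    from homog_comp_homog_mult[OF this] show ?case using that
      by (simp add: J_def ideal_zero_mem[OF I] ideal_mult_mem[OF I])
  qed
  have "ideal J ring_of_type_algebra"
    unfolding ideal_ring_of_type_algebra_iff
    using mult by (simp add: J_def homog_comp_zero homog_comp_add ideal_zero_mem[OF I] ideal_add_mem[OF I])
  moreover have "G \<subseteq> J"
  proof
    fix g assume g: "g \<in> G"
    then obtain d where "g \<in> homog_part d" using G(1) by blast
    then show "g \<in> J" using g GI by (auto simp: J_def homog_comp_of_homog ideal_zero_mem[OF I])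
  qed
  ultimately have "I \<subseteq> J" unfolding G(2) by (rule genideal_minimal)
  then show ?thesis using assms(2) by (auto simp: J_def)
qed

section \<open>Dehomogenisation\<close>

text \<open>The linear form \<open>h\<close> takes the place of a new homogenising variable.
  Components above degree \<open>N\<close> are dropped, so \<open>N\<close> has to be chosen
  large.\<close>

definition homogenize :: "('n::finite, 'k::field) mvpoly \<Rightarrow> nat \<Rightarrow> ('n, 'k) mvpoly \<Rightarrow> ('n, 'k) mvpoly"
  where "homogenize h N f = (\<Sum>k\<le>N. h ^ (N - k) * homog_comp k f)"

lemma homogenize_in_homog_part:
  assumes "h \<in> homog_part 1"
  shows "homogenize h N f \<in> homog_part N"
  unfolding homogenize_def
proof (rule homog_part_sum)
  fix k assume "k \<in> {..N}"
  then show "h ^ (N - k) * homog_comp k f \<in> homog_part N"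
    using homog_part_mult[OF homog_part_power[OF assms] homog_comp_in_homog_part, of "N - k" k f] by simp
qed

text \<open>Multiplication by \<open>h\<close> raises each component by one degree, which saves one
  power of \<open>h\<close> in the lift. The bound on \<open>b\<close> ensures that
  \<open>h * b\<close> has nothing above \<open>N\<close>.\<close>

lemma homogenize_mult:
  assumes h: "h \<in> homog_part 1" and b: "\<forall>k\<ge>N. homog_comp k b = 0"
  shows "homogenize h N (h * b) = homogenize h N b"
proof -
  have pow: "h * h ^ (N - Suc k) = h ^ (N - k)" if "k < N" for k
    using that by (metis Suc_diff_Suc power_Suc)
  have "homogenize h N (h * b) = (\<Sum>k\<le>N. if k = 0 then 0 else h ^ (N - k) * (h * homog_comp (k - 1) b))"
    unfolding homogenize_def by (rule sum.cong) (auto simp: homog_comp_homog_mult[OF h])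
  \<comment> \<open>The term in degree 0 vanishes; the others are indexed by successors, so
    \<open>k - 1\<close> is not truncated.\<close>
  also have "\<dots> = (\<Sum>k\<in>Suc ` {..<N}. h ^ (N - k) * (h * homog_comp (k - 1) b))"
    by (rule sum.mono_neutral_cong_right) (auto simp: image_iff elim: not0_implies_Suc intro: Suc_pred[symmetric])
  also have "\<dots> = (\<Sum>k<N. h ^ (N - k) * homog_comp k b)"
    by (subst sum.reindex) (auto intro!: sum.cong simp: pow[symmetric] ac_simps)
  also have "\<dots> = homogenize h N b"
    unfolding homogenize_def by (rule sum.mono_neutral_left) (use b in auto)
  finally show ?thesis .
qed

text \<open>Homogenising with \<open>h\<close> kills the multiples of \<open>h - 1\<close>, so the dehomogenisation
  \<open>S/I \<rightarrow> S/(I, h - 1)\<close> is injective on forms of a fixed degree.\<close>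

lemma homog_mem_of_dehomog:
  assumes I: "ideal I ring_of_type_algebra" "graded_ideal I"
    and h: "h \<in> homog_part 1" "\<And>x. x * h \<in> I \<Longrightarrow> x \<in> I"
    and x: "x \<in> homog_part n" and a: "a \<in> I" "x = a + (h - 1) * b"
  shows "x \<in> I"
proof -
  obtain M where M: "\<forall>k>M. homog_comp k b = 0" using exists_degree_bound by blast
  \<comment> \<open>At least \<open>n\<close>, so that \<open>x\<close> lifts to
    \<open>h ^ (N - n) * x\<close>, and above all components of \<open>b\<close>, so that
    \<open>h * b\<close> and \<open>b\<close> have the same lift.\<close>
  define N where "N = Suc (max n M)"
  have b: "\<forall>k\<ge>N. homog_comp k b = 0" using M by (simp add: N_def)
  have "homogenize h N x = homogenize h N a + (homogenize h N (h * b) - homogenize h N b)"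
    unfolding a(2) by (simp add: homogenize_def homog_comp_add homog_comp_diff
        left_diff_distrib algebra_simps sum.distrib sum_subtractf)
  also have "\<dots> = homogenize h N a" by (simp add: homogenize_mult[OF h(1) b])
  also have "\<dots> \<in> I" unfolding homogenize_def
    by (intro ideal_sum_mem[OF I(1)] ideal_mult_mem[OF I(1)] homog_comp_graded_ideal[OF I(2) a(1)])
  finally have "homogenize h N x \<in> I" .
  moreover have "homogenize h N x = (\<Sum>k\<in>{n}. h ^ (N - k) * x)"
    unfolding homogenize_def
    by (rule sum.mono_neutral_cong_right) (auto simp: homog_comp_of_homog[OF x] N_def)
  ultimately have "h ^ (N - n) * x \<in> I" by simp
  \<comment> \<open>Powers of \<open>h\<close> cancel because \<open>h\<close> is regular on
    \<open>S/I\<close>.\<close>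
  moreover have "h ^ j * x \<in> I \<Longrightarrow> x \<in> I" for j
  proof (induction j)
    case (Suc j)
    have "(h ^ j * x) * h \<in> I" using Suc.prems by (simp add: ac_simps)
    then show ?case using Suc.IH h(2) by blast
  qed simp
  ultimately show ?thesis by blast
qed

lemma sub_power_mult_mem:
  fixes J :: "'a::comm_ring_1 set"
  assumes "ideal J ring_of_type_algebra" "h - 1 \<in> J"
  shows "x - h ^ j * x \<in> J"
proof -
  have "h ^ j - 1 \<in> J"
  proof (induction j)
    case (Suc j)
    have "h ^ Suc j - 1 = h * (h ^ j - 1) + (h - 1)" by (simp add: algebra_simps)
    then show ?case using Suc assms by (metis ideal_add_mem ideal_mult_mem)
  qed (simp add: ideal_zero_mem[OF assms(1)])
  then have "- x * (h ^ j - 1) \<in> J" by (rule ideal_mult_mem[OF assms(1)])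
  then show ?thesis by (simp add: algebra_simps)
qed

text \<open>Modulo \<open>J\<close> the form \<open>h\<close> is 1, so lifting all components of
  \<open>f\<close> to a sufficiently high common degree does not change the class of
  \<open>f\<close>.\<close>

lemma exists_homog_representative:
  assumes J: "ideal J ring_of_type_algebra" "h - 1 \<in> J" and h: "h \<in> homog_part 1"
  shows "\<exists>N. \<forall>n\<ge>N. \<exists>g\<in>homog_part n. f - g \<in> J"
proof -
  obtain N where N: "\<forall>k>N. homog_comp k f = 0" using exists_degree_bound by blast
  have "f - homogenize h n f \<in> J" if "n \<ge> N" for n
  proof -
    have "\<forall>k>n. homog_comp k f = 0" using N that by simp
    from sum_homog_comp[OF this]
    have "f - homogenize h n f = (\<Sum>k\<le>n. homog_comp k f - h ^ (n - k) * homog_comp k f)"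
      by (simp add: homogenize_def sum_subtractf)
    also have "\<dots> \<in> J" by (intro ideal_sum_mem[OF J(1)] sub_power_mult_mem[OF J])
    finally show ?thesis .
  qed
  then show ?thesis using homogenize_in_homog_part[OF h] by blast
qed

section \<open>Evaluation along a line through the origin\<close>

abbreviation cst :: "'k::field \<Rightarrow> ('n::finite, 'k) mvpoly" where
  "cst \<equiv> Poly_Mapping.single 0"

lemma cst_mult: "cst (a * b) = cst a * cst b"
  by (simp add: mult_single)

lemma cst_sum: "cst (sum f A) = (\<Sum>i\<in>A. cst (f i))"
  by (induction A rule: infinite_finite_induct) (simp_all add: single_add)

lemma vector_space_mvpoly: "vector_space (\<lambda>c (f :: ('n::finite, 'k::field) mvpoly). cst c * f)"
  by unfold_locales (simp_all add: algebra_simps single_add cst_mult)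

interpretation mv: vector_space "\<lambda>c (f :: ('n::finite, 'k::field) mvpoly). cst c * f"
  by (rule vector_space_mvpoly)

lemma subspace_ideal:
  fixes J :: "('n::finite, 'k::field) mvpoly set"
  assumes "ideal J ring_of_type_algebra"
  shows "mv.subspace J"
  by (rule mv.subspaceI)
    (auto intro: ideal_zero_mem[OF assms] ideal_add_mem[OF assms] ideal_mult_mem[OF assms])

lemma subspace_homog_part: "mv.subspace (homog_part d)"
  by (rule mv.subspaceI) (auto intro: zero_in_homog_part homog_part_add homog_part_scale)

lemma subspace_add_line:
  assumes "mv.subspace Q"
  shows "mv.subspace {q + cst b * v |q b. q \<in> Q}"
proof (rule mv.subspaceI)
  show "0 \<in> {q + cst b * v |q b. q \<in> Q}"
    using mv.subspace_0[OF assms] by (intro CollectI exI[of _ 0]) simp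
next
  fix x y assume "x \<in> {q + cst b * v |q b. q \<in> Q}" "y \<in> {q + cst b * v |q b. q \<in> Q}"
  then obtain q b q' b' where "x = q + cst b * v" "y = q' + cst b' * v" "q \<in> Q" "q' \<in> Q" by blast
  then have "x + y = (q + q') + cst (b + b') * v" "q + q' \<in> Q"
    by (simp_all add: single_add distrib_right mv.subspace_add[OF assms])
  then show "x + y \<in> {q + cst b * v |q b. q \<in> Q}" by blast
next
  fix c x assume "x \<in> {q + cst b * v |q b. q \<in> Q}"
  then obtain q b where "x = q + cst b * v" and q: "q \<in> Q" by blast
  then have "cst c * x = cst c * q + cst (c * b) * v"
    by (simp only: cst_mult distrib_left mult.assoc)
  moreover have "cst c * q \<in> Q" by (rule mv.subspace_scale[OF assms q])
  ultimately show "cst c * x \<in> {q + cst b * v |q b. q \<in> Q}" by blast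
qed

text \<open>The substitution of \<open>c i * X\<close> for the variable \<open>i\<close>. For
  nonzero \<open>c\<close> its kernel is the prime of the line through \<open>c\<close>; polynomial
  values, rather than values at points of the line, make this correct over finite fields
  too.\<close>

definition line_eval :: "('n::finite \<Rightarrow> 'k::field) \<Rightarrow> ('n, 'k) mvpoly \<Rightarrow> 'k poly" where
  "line_eval c f = (\<Sum>m\<in>Poly_Mapping.keys f.
     Polynomial.monom (Poly_Mapping.lookup f m * (\<Prod>i\<in>UNIV. c i ^ Poly_Mapping.lookup m i)) (mon_deg m))"

lemma line_eval_superset:
  assumes "finite A" "Poly_Mapping.keys f \<subseteq> A"
  shows "line_eval c f = (\<Sum>m\<in>A.
     Polynomial.monom (Poly_Mapping.lookup f m * (\<Prod>i\<in>UNIV. c i ^ Poly_Mapping.lookup m i)) (mon_deg m))"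
  unfolding line_eval_def using assms by (intro sum.mono_neutral_left) (auto simp: in_keys_iff)

lemma line_eval_add: "line_eval c (f + g) = line_eval c f + line_eval c g"
proof -
  define A where "A = Poly_Mapping.keys f \<union> Poly_Mapping.keys g"
  have A: "finite A" "Poly_Mapping.keys f \<subseteq> A" "Poly_Mapping.keys g \<subseteq> A" "Poly_Mapping.keys (f + g) \<subseteq> A"
    using Poly_Mapping.keys_add[of f g] by (auto simp: A_def)
  show ?thesis
    unfolding line_eval_superset[OF A(1,2)] line_eval_superset[OF A(1,3)] line_eval_superset[OF A(1,4)]
    by (simp add: lookup_add distrib_right flip: sum.distrib add_monom)
qed

lemma line_eval_single:
  "line_eval c (Poly_Mapping.single m a) =
     Polynomial.monom (a * (\<Prod>i\<in>UNIV. c i ^ Poly_Mapping.lookup m i)) (mon_deg m)"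
  using line_eval_superset[of "{m}" "Poly_Mapping.single m a" c] by simp

lemma line_eval_mult: "line_eval c (f * g) = line_eval c f * line_eval c g"
proof (induction f rule: poly_mapping_single_induct)
  case (add f f')
  then show ?case by (simp add: distrib_right line_eval_add)
next
  case (single m a)
  show ?case
  proof (induction g rule: poly_mapping_single_induct)
    case (add g g')
    then show ?case by (simp add: distrib_left line_eval_add)
  next
    case (single m' b)
    show ?case
      by (simp add: mult_single line_eval_single mult_monom mon_deg_add lookup_add power_add
          prod.distrib ac_simps)
  qed
qed

lemma line_eval_zero: "line_eval c 0 = 0"
  by (simp add: line_eval_def)

lemma line_eval_one: "line_eval c 1 = 1"
  using line_eval_single[of c 0 1] by simp

text \<open>Only the monomial 1 has degree 0. Hence a polynomial vanishing on a line has no constant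
  term.\<close>

lemma coeff_line_eval_0: "Polynomial.coeff (line_eval c f) 0 = Poly_Mapping.lookup f 0"
proof (induction f rule: poly_mapping_single_induct)
  case (add f g)
  then show ?case by (simp add: line_eval_add lookup_add)
next
  case (single m a)
  show ?case by (cases "m = 0") (auto simp: line_eval_single lookup_single when_def mon_deg_eq_0_iff)
qed

lemma primeideal_line_eval_kernel:
  "primeideal {f. line_eval c f = 0} ring_of_type_algebra"
  by (simp add: primeideal_ring_of_type_algebra_iff ideal_ring_of_type_algebra_iff
      line_eval_zero line_eval_one line_eval_add line_eval_mult)

lemma primeideal_zero_const_coeff:
  "primeideal {f :: ('n::finite, 'k::field) mvpoly. Poly_Mapping.lookup f 0 = 0} ring_of_type_algebra"
proof -
  have "Poly_Mapping.lookup (f * g) 0 = Poly_Mapping.lookup f 0 * Poly_Mapping.lookup g 0"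
    for f g :: "('n, 'k) mvpoly"
    using coeff_line_eval_0[of "\<lambda>_. 0"] by (metis coeff_mult_0 line_eval_mult)
  then show ?thesis
    by (auto simp: primeideal_ring_of_type_algebra_iff ideal_ring_of_type_algebra_iff lookup_add)
qed

lemma linear_form_lookup_0:
  assumes "f \<in> homog_part 1"
  shows "Poly_Mapping.lookup f 0 = 0"
proof (rule ccontr)
  assume "Poly_Mapping.lookup f 0 \<noteq> 0"
  then have "0 \<in> Poly_Mapping.keys f" by (simp add: in_keys_iff)
  then have "mon_deg (0 :: 'a \<Rightarrow>\<^sub>0 nat) = 1" using assms unfolding homog_part_iff by blast
  then show False by simp
qed

text \<open>A basis of \<open>W\<close> is extended by \<open>h\<close>, with prescribed values 0
  and 1. The values of such a functional at the variables are the coordinates of a point, and thus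
  determine a line.\<close>

lemma exists_functional:
  fixes h :: "('n::finite, 'k::field) mvpoly"
  assumes W: "mv.subspace W" and h: "h \<notin> W"
  obtains \<phi> :: "('n, 'k) mvpoly \<Rightarrow> 'k" where
    "\<And>f g. \<phi> (f + g) = \<phi> f + \<phi> g" "\<And>c f. \<phi> (cst c * f) = c * \<phi> f"
    "\<And>f. f \<in> W \<Longrightarrow> \<phi> f = 0" "\<phi> h = 1"
proof -
  interpret K: vector_space "\<lambda>c (x :: 'k). c * x" by unfold_locales (simp_all add: algebra_simps)
  interpret vector_space_pair "\<lambda>c (f :: ('n, 'k) mvpoly). cst c * f" "\<lambda>c (x :: 'k). c * x" ..
  obtain B where B: "B \<subseteq> W" "mv.independent B" "W \<subseteq> mv.span B"
    using mv.maximal_independent_subset by blast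
  have "mv.span B \<subseteq> W" by (rule mv.span_minimal[OF B(1) W])
  then have "mv.independent (insert h B)" using h B(2) by (intro mv.independent_insertI) auto
  from linear_independent_extend[OF this, of "\<lambda>x. if x = h then 1 else 0"]
  obtain \<phi> where \<phi>: "Vector_Spaces.linear (\<lambda>c f. cst c * f) (\<lambda>c x. c * x) \<phi>"
    "\<And>x. x \<in> insert h B \<Longrightarrow> \<phi> x = (if x = h then 1 else 0)" by blast
  have "\<phi> x = 0" if "x \<in> B" for x using \<phi>(2)[of x] that h B(1) by auto
  then have "\<phi> f = 0" if "f \<in> W" for f
    using linear_eq_0_on_span[OF \<phi>(1), of B f] that B(3) by blast
  moreover have "\<phi> h = 1" using \<phi>(2)[of h] by simp
  ultimately show thesis
    using that[of \<phi>] linear_add[OF \<phi>(1)] linear_scale[OF \<phi>(1)] by blast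
qed

text \<open>Evaluating a linear form at the point with coordinates \<phi>(t_i) gives its value under
  \<phi>. So the prime of the line contains exactly those linear forms that \<phi> kills.\<close>

lemma line_eval_linear_form:
  fixes \<phi> :: "('n::finite, 'k::field) mvpoly \<Rightarrow> 'k"
  assumes \<phi>: "\<And>f g. \<phi> (f + g) = \<phi> f + \<phi> g" "\<And>c f. \<phi> (cst c * f) = c * \<phi> f"
    and f: "f \<in> homog_part 1"
  shows "line_eval (\<lambda>i. \<phi> (Poly_Mapping.single (Poly_Mapping.single i 1) 1)) f = Polynomial.monom (\<phi> f) 1"
proof -
  define c where "c i = \<phi> (Poly_Mapping.single (Poly_Mapping.single i 1) 1)" for i
  have \<phi>0: "\<phi> 0 = 0" using \<phi>(2)[of 0 0] by simp
  have \<phi>sum: "\<phi> (sum g A) = (\<Sum>i\<in>A. \<phi> (g i))" for g and A :: "('n \<Rightarrow>\<^sub>0 nat) set"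
    by (induction A rule: infinite_finite_induct) (simp_all add: \<phi>0 \<phi>(1))
  have term_eq: "Poly_Mapping.lookup f m * (\<Prod>i\<in>UNIV. c i ^ Poly_Mapping.lookup m i) =
      \<phi> (Poly_Mapping.single m (Poly_Mapping.lookup f m))" if "m \<in> Poly_Mapping.keys f" for m
  proof -
    have "mon_deg m = Suc 0" using f that by (simp add: homog_part_iff)
    then obtain i m' where "m = m' + Poly_Mapping.single i 1" "mon_deg m' = 0"
      using mon_deg_Suc_split by blast
    then have m: "m = Poly_Mapping.single i 1" by (simp add: mon_deg_eq_0_iff)
    have "(\<Prod>j\<in>UNIV. c j ^ Poly_Mapping.lookup m j) = (\<Prod>j\<in>UNIV. if j = i then c j else 1)"
      unfolding m by (rule prod.cong) (auto simp: lookup_single when_def)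
    also have "\<dots> = c i" by simp
    finally have "(\<Prod>j\<in>UNIV. c j ^ Poly_Mapping.lookup m j) = \<phi> (Poly_Mapping.single m 1)"
      by (simp add: c_def m)
    then show ?thesis
      using \<phi>(2)[of "Poly_Mapping.lookup f m" "Poly_Mapping.single m 1"] by (simp add: mult_single)
  qed
  have "line_eval c f = (\<Sum>m\<in>Poly_Mapping.keys f.
      Polynomial.monom (\<phi> (Poly_Mapping.single m (Poly_Mapping.lookup f m))) 1)"
    unfolding line_eval_def
    by (rule sum.cong) (use f term_eq in \<open>auto simp: homog_part_iff\<close>)
  also have "\<dots> = Polynomial.monom (\<phi> (\<Sum>m\<in>Poly_Mapping.keys f. Poly_Mapping.single m (Poly_Mapping.lookup f m))) 1"
    by (simp add: \<phi>sum monom_sum)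
  also have "\<dots> = Polynomial.monom (\<phi> f) 1" using poly_mapping_sum_singles[of f] by simp
  finally show ?thesis by (simp add: c_def[abs_def])
qed

text \<open>If the linear forms have rank at least two modulo \<open>p\<close>, the prime of a line through
  the origin fits strictly between \<open>p\<close> and the irrelevant ideal.\<close>

lemma exists_prime_between:
  fixes p :: "('n::finite, 'k::field) mvpoly set"
  assumes p: "generated_by_linear_forms p" "ideal p ring_of_type_algebra"
    and h: "h \<in> homog_part 1" "h \<notin> p"
    and l: "l \<in> homog_part 1" "\<And>c. l - cst c * h \<notin> p"
  shows "\<exists>q. primeideal q ring_of_type_algebra \<and> p \<subset> q \<and> q \<subset> {f. Poly_Mapping.lookup f 0 = 0}"
proof -
  interpret R: cring "ring_of_type_algebra :: ('n, 'k) mvpoly ring" by rule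
  \<comment> \<open>A functional that is 0 on \<open>W\<close> and 1 at \<open>h\<close> yields a
    prime that contains \<open>l\<close>, which is not in \<open>p\<close>, and misses
    \<open>h\<close>, which has no constant term. It exists because \<open>h\<close> in
    \<open>W\<close> would make \<open>l\<close> a multiple of \<open>h\<close> modulo
    \<open>p\<close>.\<close>
  define W where "W = {a + cst b * l |a b. a \<in> p}"
  have "mv.subspace W" unfolding W_def by (rule subspace_add_line[OF subspace_ideal[OF p(2)]])
  moreover have "h \<notin> W"
  proof
    assume "h \<in> W"
    then obtain a b where ab: "h = a + cst b * l" "a \<in> p" unfolding W_def by blast
    then have "b \<noteq> 0" using h(2) by auto
    then have "cst (1 / b) * cst b = (1 :: ('n, 'k) mvpoly)" by (simp flip: cst_mult)
    then have "cst (1 / b) * h = cst (1 / b) * a + l"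
      by (simp add: ab(1) distrib_left flip: mult.assoc)
    moreover have "l - (x + l) = - x" for x by simp
    ultimately have "l - cst (1 / b) * h = - (cst (1 / b) * a)" by simp
    moreover have "- (cst (1 / b) * a) \<in> p"
      by (rule ideal_uminus_mem[OF p(2) ideal_mult_mem[OF p(2) ab(2)]])
    ultimately show False using l(2)[of "1 / b"] by simp
  qed
  ultimately obtain \<phi> :: "('n, 'k) mvpoly \<Rightarrow> 'k" where
    \<phi>: "\<And>f g. \<phi> (f + g) = \<phi> f + \<phi> g" "\<And>c f. \<phi> (cst c * f) = c * \<phi> f"
    "\<And>f. f \<in> W \<Longrightarrow> \<phi> f = 0" "\<phi> h = 1"
    using exists_functional by blast
  define c where "c i = \<phi> (Poly_Mapping.single (Poly_Mapping.single i 1) 1)" for i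
  define q where "q = {f. line_eval c f = 0}"
  have ev: "line_eval c f = Polynomial.monom (\<phi> f) 1" if "f \<in> homog_part 1" for f
    using line_eval_linear_form[OF \<phi>(1,2) that] by (simp add: c_def[abs_def])
  have q: "primeideal q ring_of_type_algebra"
    unfolding q_def by (rule primeideal_line_eval_kernel)
  have pW: "a \<in> W" if "a \<in> p" for a
    unfolding W_def using that by (intro CollectI exI[of _ a] exI[of _ 0]) simp
  have "l \<in> W" unfolding W_def using ideal_zero_mem[OF p(2)]
    by (intro CollectI exI[of _ 0] exI[of _ 1]) simp
  then have "l \<in> q" using ev[OF l(1)] \<phi>(3) by (simp add: q_def)
  have "l \<notin> p" using l(2)[of 0] by simp
  obtain G where G: "G \<subseteq> homog_part 1" "p = Idl\<^bsub>ring_of_type_algebra\<^esub> G"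
    using p(1) by (auto simp: generated_by_linear_forms_def mpoly_ring_def)
  have "G \<subseteq> p" unfolding G(2) by (rule R.genideal_self) simp
  then have "G \<subseteq> q" using G(1) ev \<phi>(3) pW unfolding q_def by fastforce
  then have "p \<subseteq> q" unfolding G(2)
    by (intro R.genideal_minimal primeideal.axioms(1)[OF q])
  then have "p \<subset> q" using \<open>l \<in> q\<close> \<open>l \<notin> p\<close> by blast
  moreover have "q \<subseteq> {f. Poly_Mapping.lookup f 0 = 0}"
    using coeff_line_eval_0[of c] unfolding q_def by (metis (mono_tags) coeff_0 Collect_mono)
  moreover have "h \<notin> q" using ev[OF h(1)] \<phi>(4) by (simp add: q_def)
  ultimately show ?thesis using q linear_form_lookup_0[OF h(1)] by blast
qed

lemma linear_ideal_psubset_irrelevant: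
  assumes "generated_by_linear_forms p" "h \<in> homog_part 1" "h \<notin> p"
  shows "p \<subset> {f. Poly_Mapping.lookup f 0 = 0}"
proof -
  interpret R: cring "ring_of_type_algebra :: ('a, 'b) mvpoly ring" by rule
  obtain G where G: "G \<subseteq> homog_part 1" "p = Idl\<^bsub>ring_of_type_algebra\<^esub> G"
    using assms(1) by (auto simp: generated_by_linear_forms_def mpoly_ring_def)
  have "G \<subseteq> {f. Poly_Mapping.lookup f 0 = 0}" using G(1) linear_form_lookup_0 by blast
  then have "p \<subseteq> {f. Poly_Mapping.lookup f 0 = 0}" unfolding G(2)
    by (intro R.genideal_minimal primeideal.axioms(1)[OF primeideal_zero_const_coeff])
  then show ?thesis using assms(2,3) linear_form_lookup_0 by blast
qed

text \<open>Peeling off one variable at a time, each is replaced by a multiple of \<open>h\<close>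
  modulo \<open>p\<close>; so \<open>h ^ d\<close> spans degree \<open>d\<close> of
  \<open>S/p\<close>.\<close>

lemma form_cong_power:
  fixes p :: "('n::finite, 'k::field) mvpoly set"
  assumes p: "ideal p ring_of_type_algebra"
    and h: "\<And>l. l \<in> homog_part 1 \<Longrightarrow> \<exists>c. l - cst c * h \<in> p"
    and f: "f \<in> homog_part d"
  shows "\<exists>c. f - cst c * h ^ d \<in> p"
proof -
  have mon: "\<exists>c. Poly_Mapping.single m a - cst c * h ^ d \<in> p" if "mon_deg m = d" for m a d
    using that
  proof (induction d arbitrary: m)
    case 0
    then show ?case
      by (intro exI[of _ a]) (simp add: mon_deg_eq_0_iff ideal_zero_mem[OF p])
  next
    case (Suc d)
    then obtain i m' where m: "m = m' + Poly_Mapping.single i 1" "mon_deg m' = d"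
      using mon_deg_Suc_split by blast
    obtain c where c: "Poly_Mapping.single m' a - cst c * h ^ d \<in> p" using Suc.IH[OF m(2)] by blast
    let ?t = "Poly_Mapping.single (Poly_Mapping.single i 1) 1"
    have "?t \<in> homog_part 1" by (simp add: single_in_homog_part mon_deg_single)
    then obtain e where e: "?t - cst e * h \<in> p" using h by blast
    have "Poly_Mapping.single m a = Poly_Mapping.single m' a * ?t" by (simp add: m(1) mult_single)
    moreover have "cst (c * e) * h ^ Suc d = (cst c * h ^ d) * (cst e * h)"
      by (simp only: cst_mult power_Suc ac_simps)
    \<comment> \<open>The identity behind multiplying two congruences modulo
      \<open>p\<close>.\<close>
    moreover have "x * t - y * z = t * (x - y) + y * (t - z)" for x y z t :: "('n, 'k) mvpoly"
      by (simp add: algebra_simps)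
    ultimately have "Poly_Mapping.single m a - cst (c * e) * h ^ Suc d =
      ?t * (Poly_Mapping.single m' a - cst c * h ^ d) + (cst c * h ^ d) * (?t - cst e * h)"
      by metis
    then have "Poly_Mapping.single m a - cst (c * e) * h ^ Suc d \<in> p"
      using ideal_add_mem[OF p ideal_mult_mem[OF p c] ideal_mult_mem[OF p e]] by metis
    then show ?case by blast
  qed
  have "\<forall>m\<in>Poly_Mapping.keys f. \<exists>c. Poly_Mapping.single m (Poly_Mapping.lookup f m) - cst c * h ^ d \<in> p"
    using mon f by (simp add: homog_part_iff)
  then obtain c where c: "\<And>m. m \<in> Poly_Mapping.keys f \<Longrightarrow>
      Poly_Mapping.single m (Poly_Mapping.lookup f m) - cst (c m) * h ^ d \<in> p"
    by metis
  have "f - cst (\<Sum>m\<in>Poly_Mapping.keys f. c m) * h ^ d =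
      (\<Sum>m\<in>Poly_Mapping.keys f. Poly_Mapping.single m (Poly_Mapping.lookup f m) - cst (c m) * h ^ d)"
    using poly_mapping_sum_singles[of f] by (simp add: cst_sum sum_subtractf sum_distrib_right)
  also have "\<dots> \<in> p" by (rule ideal_sum_mem[OF p c])
  finally show ?thesis by blast
qed

section \<open>Dimension modulo an ideal\<close>

text \<open>Steinitz exchange modulo \<open>Q\<close>: the last spanning vector is absorbed into
  \<open>Q\<close>, and two relations modulo the enlarged space are combined to eliminate
  it.\<close>

lemma exists_relation_mod:
  fixes u :: "'i \<Rightarrow> ('n::finite, 'k::field) mvpoly"
  assumes "finite A" "mv.subspace Q" "m < card A"
    and "\<And>x. x \<in> A \<Longrightarrow> \<exists>a. u x - (\<Sum>j<m. cst (a j) * v j) \<in> Q"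
  shows "\<exists>c. (\<exists>x\<in>A. c x \<noteq> 0) \<and> (\<Sum>x\<in>A. cst (c x) * u x) \<in> Q"
  using assms
proof (induction m arbitrary: A Q)
  case 0
  then have "A \<noteq> {}" by auto
  then obtain x where x: "x \<in> A" by blast
  have "u x \<in> Q" if "x \<in> A" for x using "0.prems"(4)[OF that] by simp
  then have "(\<Sum>x\<in>A. cst 1 * u x) \<in> Q"
    using mv.subspace_sum[OF "0.prems"(2), of A u] by simp
  then show ?case using x by (intro exI[of _ "\<lambda>_. 1"]) auto
next
  case (Suc m)
  define Q' where "Q' = {q + cst b * v m |q b. q \<in> Q}"
  have Q': "mv.subspace Q'" unfolding Q'_def by (rule subspace_add_line[OF Suc.prems(2)])
  have spans: "\<exists>a. u x - (\<Sum>j<m. cst (a j) * v j) \<in> Q'" if x: "x \<in> A" for x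
  proof -
    obtain a where a: "u x - (\<Sum>j<Suc m. cst (a j) * v j) \<in> Q" using Suc.prems(4)[OF x] by blast
    have "u x - (\<Sum>j<m. cst (a j) * v j) = (u x - (\<Sum>j<Suc m. cst (a j) * v j)) + cst (a m) * v m"
      by simp
    then show ?thesis using a unfolding Q'_def by blast
  qed
  \<comment> \<open>Omitting \<open>x0\<close> before using the induction hypothesis yields a
    relation with coefficient 0 at a prescribed place.\<close>
  have relation: "\<exists>c. (\<exists>x\<in>A - {x0}. c x \<noteq> 0) \<and> c x0 = 0 \<and> (\<Sum>x\<in>A. cst (c x) * u x) \<in> Q'"
    if x0: "x0 \<in> A" for x0
  proof -
    have "m < card (A - {x0})" using Suc.prems(1,3) x0 by simp
    then have "\<exists>c. (\<exists>x\<in>A - {x0}. c x \<noteq> 0) \<and> (\<Sum>x\<in>A - {x0}. cst (c x) * u x) \<in> Q'"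
    proof (rule Suc.IH[OF finite_Diff[OF Suc.prems(1)] Q'])
      fix x assume "x \<in> A - {x0}"
      then show "\<exists>a. u x - (\<Sum>j<m. cst (a j) * v j) \<in> Q'" using spans[of x] by blast
    qed
    then obtain c where c: "\<exists>x\<in>A - {x0}. c x \<noteq> 0" "(\<Sum>x\<in>A - {x0}. cst (c x) * u x) \<in> Q'"
      by blast
    define c' where "c' = c(x0 := 0)"
    have "(\<Sum>x\<in>A. cst (c' x) * u x) = cst (c' x0) * u x0 + (\<Sum>x\<in>A - {x0}. cst (c' x) * u x)"
      by (rule sum.remove[OF Suc.prems(1) x0])
    also have "(\<Sum>x\<in>A - {x0}. cst (c' x) * u x) = (\<Sum>x\<in>A - {x0}. cst (c x) * u x)"
      by (rule sum.cong) (simp_all add: c'_def)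
    finally have "(\<Sum>x\<in>A. cst (c' x) * u x) = (\<Sum>x\<in>A - {x0}. cst (c x) * u x)"
      by (simp add: c'_def)
    then show ?thesis using c by (intro exI[of _ c']) (auto simp: c'_def)
  qed
  have "A \<noteq> {}" using Suc.prems(3) by auto
  then obtain x0 where "x0 \<in> A" by blast
  then obtain c1 x1 where c1: "x1 \<in> A" "c1 x1 \<noteq> 0" "(\<Sum>x\<in>A. cst (c1 x) * u x) \<in> Q'"
    using relation by blast
  obtain c2 where c2: "\<exists>x\<in>A. c2 x \<noteq> 0" "c2 x1 = 0" "(\<Sum>x\<in>A. cst (c2 x) * u x) \<in> Q'"
    using relation[OF c1(1)] by blast
  obtain q1 b1 where q1: "(\<Sum>x\<in>A. cst (c1 x) * u x) = q1 + cst b1 * v m" "q1 \<in> Q"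
    using c1(3) unfolding Q'_def by blast
  obtain q2 b2 where q2: "(\<Sum>x\<in>A. cst (c2 x) * u x) = q2 + cst b2 * v m" "q2 \<in> Q"
    using c2(3) unfolding Q'_def by blast
  show ?case
  proof (cases "b2 = 0")
    case True
    then show ?thesis using c2(1) q2 by auto
  next
    case False
    \<comment> \<open>The multiples of \<open>v m\<close> cancel; at \<open>x1\<close> only the
      first relation contributes, so the combination is nontrivial.\<close>
    define c where "c x = b2 * c1 x - b1 * c2 x" for x
    have "(\<Sum>x\<in>A. cst (c x) * u x) =
        cst b2 * (\<Sum>x\<in>A. cst (c1 x) * u x) - cst b1 * (\<Sum>x\<in>A. cst (c2 x) * u x)"
      by (simp only: c_def single_diff cst_mult left_diff_distrib sum_subtractf sum_distrib_left mult.assoc)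
    also have "\<dots> = cst b2 * q1 - cst b1 * q2"
    proof -
      have "x * (q + y * v) - y * (r + x * v) = x * q - y * r" for x y q r v :: "('n, 'k) mvpoly"
        by (simp add: algebra_simps)
      then show ?thesis unfolding q1(1) q2(1) .
    qed
    also have "\<dots> \<in> Q"
      by (intro mv.subspace_diff[OF Suc.prems(2)] mv.subspace_scale[OF Suc.prems(2)] q1(2) q2(2))
    finally have "(\<Sum>x\<in>A. cst (c x) * u x) \<in> Q" .
    moreover have "c x1 \<noteq> 0" using False c1(2) c2(2) by (simp add: c_def)
    ultimately show ?thesis using c1(1) by blast
  qed
qed

text \<open>Dimensions of quotients are treated on representatives in \<open>S\<close>; the
  dimension defined through cosets enters only in \<open>quot_dim_eq\<close>.\<close>

definition indep_mod :: "('n::finite, 'k::field) mvpoly set \<Rightarrow> nat \<Rightarrow> (nat \<Rightarrow> ('n, 'k) mvpoly) \<Rightarrow> bool" where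
  "indep_mod J n u \<longleftrightarrow> (\<forall>a. (\<Sum>i<n. cst (a i) * u i) \<in> J \<longrightarrow> (\<forall>i<n. a i = 0))"

definition spans_mod :: "('n::finite, 'k::field) mvpoly set \<Rightarrow> ('n, 'k) mvpoly set \<Rightarrow> nat \<Rightarrow>
    (nat \<Rightarrow> ('n, 'k) mvpoly) \<Rightarrow> bool" where
  "spans_mod J V n u \<longleftrightarrow> (\<forall>f\<in>V. \<exists>a. f - (\<Sum>i<n. cst (a i) * u i) \<in> J)"

definition basis_mod :: "('n::finite, 'k::field) mvpoly set \<Rightarrow> ('n, 'k) mvpoly set \<Rightarrow> nat \<Rightarrow>
    (nat \<Rightarrow> ('n, 'k) mvpoly) \<Rightarrow> bool" where
  "basis_mod J V n u \<longleftrightarrow> (\<forall>i<n. u i \<in> V) \<and> indep_mod J n u \<and> spans_mod J V n u"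

text \<open>Independence modulo the larger \<open>J'\<close> against spanning modulo the smaller
  \<open>J\<close>: dimension drops under the surjection from \<open>S/J\<close> to
  \<open>S/J'\<close>.\<close>

lemma indep_mod_le_spans_mod:
  assumes "mv.subspace J'" "J \<subseteq> J'" "\<And>i. i < n \<Longrightarrow> u i \<in> V" "indep_mod J' n u" "spans_mod J V m v"
  shows "n \<le> m"
proof (rule ccontr)
  assume "\<not> n \<le> m"
  then have "m < card {..<n}" by simp
  moreover have "\<exists>a. u x - (\<Sum>j<m. cst (a j) * v j) \<in> J'" if "x \<in> {..<n}" for x
    using assms(2,3,5) that unfolding spans_mod_def by blast
  ultimately obtain c where "\<exists>x\<in>{..<n}. c x \<noteq> 0" "(\<Sum>x<n. cst (c x) * u x) \<in> J'"
    using exists_relation_mod[of "{..<n}" J' m u v] assms(1) by blast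
  then show False using assms(4) unfolding indep_mod_def by blast
qed

text \<open>A longest independent family spans, since an element outside its span could be appended;
  \<open>m\<close> bounds the lengths.\<close>

lemma exists_basis_mod:
  assumes J: "mv.subspace J" and v: "spans_mod J V m v"
  shows "\<exists>n u. n \<le> m \<and> basis_mod J V n u"
proof -
  define S where "S = {n. \<exists>u. (\<forall>i<n. u i \<in> V) \<and> indep_mod J n u}"
  have bound: "n \<le> m" if n: "n \<in> S" for n
  proof -
    obtain u where "\<And>i. i < n \<Longrightarrow> u i \<in> V" "indep_mod J n u" using n by (auto simp: S_def)
    then show ?thesis using indep_mod_le_spans_mod[OF J order_refl _ _ v] by blast
  qed
  have "0 \<in> S" by (simp add: S_def indep_mod_def)
  moreover have "finite S" using bound finite_nat_set_iff_bounded_le by blast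
  ultimately have max: "Max S \<in> S" "\<And>k. k \<in> S \<Longrightarrow> k \<le> Max S" using Max_in by auto
  define n where "n = Max S"
  obtain u where u: "\<And>i. i < n \<Longrightarrow> u i \<in> V" "indep_mod J n u" using max(1) by (auto simp: S_def n_def)
  have "\<exists>a. f - (\<Sum>i<n. cst (a i) * u i) \<in> J" if f: "f \<in> V" for f
  proof (rule ccontr)
    assume no: "\<nexists>a. f - (\<Sum>i<n. cst (a i) * u i) \<in> J"
    define w where "w = u(n := f)"
    have "indep_mod J (Suc n) w"
      unfolding indep_mod_def
    proof (intro allI impI)
      fix a i assume "(\<Sum>i<Suc n. cst (a i) * w i) \<in> J" and i: "i < Suc n"
      then have rel: "(\<Sum>i<n. cst (a i) * u i) + cst (a n) * f \<in> J" by (simp add: w_def)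
      have an: "a n = 0"
      proof (rule ccontr)
        assume an: "a n \<noteq> 0"
        have "cst (1 / a n) * ((\<Sum>i<n. cst (a i) * u i) + cst (a n) * f) \<in> J"
          by (rule mv.subspace_scale[OF J rel])
        also have "cst (1 / a n) * ((\<Sum>i<n. cst (a i) * u i) + cst (a n) * f) =
            f - (\<Sum>i<n. cst (- a i / a n) * u i)"
        proof -
          have "cst (- a i / a n) = - (cst (1 / a n) * cst (a i))" for i
            by (simp add: single_uminus flip: cst_mult)
          moreover have "cst (1 / a n) * (cst (a n) * f) = f"
            using an by (simp flip: mult.assoc cst_mult)
          ultimately show ?thesis
            by (simp add: distrib_left sum_distrib_left sum_negf mult.assoc)
        qed
        finally show False using no by (elim notE) (rule exI)
      qed
      then have "\<forall>i<n. a i = 0" using rel u(2) unfolding indep_mod_def by simp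
      then show "a i = 0" using an i less_Suc_eq by auto
    qed
    moreover have "\<forall>i<Suc n. w i \<in> V" using u(1) f by (simp add: w_def less_Suc_eq)
    ultimately have "Suc n \<in> S" by (auto simp: S_def)
    then show False using max(2)[of "Suc n"] by (simp add: n_def)
  qed
  then have "basis_mod J V n u" using u by (simp add: basis_mod_def spans_mod_def)
  then show ?thesis using bound[OF max(1)] n_def by blast
qed

text \<open>Connects representatives with the \<open>dim\<close> inside \<open>quot_dim\<close>. By
  \<open>1 \<notin> J\<close> the constants embed as a subfield of \<open>S/J\<close>.\<close>

lemma quot_dim_eq:
  fixes J :: "('n::finite, 'k::field) mvpoly set"
  assumes J: "ideal J mpoly_ring" "1 \<notin> J" and V: "mv.subspace V" and u: "basis_mod J V n u"
  shows "quot_dim J V = n"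
proof -
  define S :: "('n, 'k) mvpoly ring" where "S = mpoly_ring"
  define R where "R = S Quot J"
  interpret S: cring S unfolding S_def mpoly_ring_def by rule
  interpret J: ideal J S unfolding S_def by (rule J(1))
  interpret R: cring R unfolding R_def by (rule J.quotient_is_cring[OF S.is_cring])
  have J': "ideal J ring_of_type_algebra" using J(1) by (simp add: mpoly_ring_def)
  define q where "q x = J +>\<^bsub>S\<^esub> x" for x
  have S_simps: "carrier S = UNIV" "x \<otimes>\<^bsub>S\<^esub> y = x * y" "x \<oplus>\<^bsub>S\<^esub> y = x + y" "\<one>\<^bsub>S\<^esub> = 1"
    "\<zero>\<^bsub>S\<^esub> = 0" "x \<ominus>\<^bsub>S\<^esub> y = x - y" for x y
    by (simp_all add: S_def mpoly_ring_def a_minus_def)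
  have q_hom: "q \<in> ring_hom S R" unfolding q_def R_def by (rule J.rcos_ring_hom)
  have q_simps: "q x \<otimes>\<^bsub>R\<^esub> q y = q (x * y)" "q x \<oplus>\<^bsub>R\<^esub> q y = q (x + y)" "q 1 = \<one>\<^bsub>R\<^esub>"
    "q x \<in> carrier R" for x y
    using ring_hom_mult[OF q_hom, of x y] ring_hom_add[OF q_hom, of x y] ring_hom_one[OF q_hom]
      ring_hom_closed[OF q_hom, of x] by (simp_all add: S_simps)
  have q_zero: "q 0 = \<zero>\<^bsub>R\<^esub>"
    using ring_hom_zero[OF q_hom S.ring_axioms R.ring_axioms] by (simp add: S_simps)
  have q_eq: "q x = q y \<longleftrightarrow> x - y \<in> J" for x y
    unfolding q_def using S.quotient_eq_iff_same_a_r_cos[OF J.ideal_axioms, of x y]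
    by (simp add: S_simps)
  define K where "K = range (\<lambda>c. q (cst c))"
  have K: "subfield K R"
  proof -
    let ?F = "ring_of_type_algebra :: 'k ring"
    interpret F: field ?F by rule
    have "(\<lambda>c. q (cst c)) \<in> ring_hom ?F R"
      by (rule ring_hom_memI) (simp_all add: q_simps single_add cst_mult)
    then interpret h: ring_hom_ring ?F R "\<lambda>c. q (cst c)"
      by (rule ring_hom_ringI2[OF F.ring_axioms R.ring_axioms])
    have "\<one>\<^bsub>R\<^esub> \<noteq> \<zero>\<^bsub>R\<^esub>"
      using q_eq[of 1 0] J(2) by (simp add: q_simps(3)[symmetric] q_zero[symmetric])
    from h.img_is_subfield(2)[OF F.carrier_is_subfield this]
    show ?thesis by (simp add: K_def)
  qed
  \<comment> \<open>Reversed, because \<open>Span\<close> and \<open>independent\<close> grow at the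
    head of a list: \<open>us (Suc k)\<close> is \<open>q (u k)\<close> followed by
    \<open>us k\<close>.\<close>
  define us where "us k = map (\<lambda>i. q (u i)) (rev [0..<k])" for k
  have Span: "R.Span K (us k) = {q (\<Sum>i<k. cst (a i) * u i) |a. True}" for k
  proof (induction k)
    case 0
    then show ?case by (simp add: us_def q_zero)
  next
    case (Suc k)
    have "R.Span K (us (Suc k)) = R.line_extension K (q (u k)) (R.Span K (us k))"
      by (simp add: us_def)
    also have "\<dots> = {q (\<Sum>i<Suc k. cst (a i) * u i) |a. True}" (is "?A = ?B")
    proof (intro equalityI subsetI)
      fix x assume "x \<in> ?A"
      then obtain c a where "x = q (cst c) \<otimes>\<^bsub>R\<^esub> q (u k) \<oplus>\<^bsub>R\<^esub> q (\<Sum>i<k. cst (a i) * u i)"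
        unfolding R.line_extension_mem_iff Suc.IH unfolding K_def by blast
      then have "x = q (\<Sum>i<Suc k. cst ((a(k := c)) i) * u i)"
        by (simp add: q_simps add.commute)
      then show "x \<in> ?B" by blast
    next
      fix x assume "x \<in> ?B"
      then obtain a where "x = q (\<Sum>i<Suc k. cst (a i) * u i)" by blast
      then have "x = q (cst (a k)) \<otimes>\<^bsub>R\<^esub> q (u k) \<oplus>\<^bsub>R\<^esub> q (\<Sum>i<k. cst (a i) * u i)"
        by (simp add: q_simps add.commute)
      then show "x \<in> ?A" unfolding R.line_extension_mem_iff Suc.IH unfolding K_def by blast
    qed
    finally show ?case .
  qed
  have ind: "indep_mod J n u" and span: "spans_mod J V n u" and uV: "\<And>i. i < n \<Longrightarrow> u i \<in> V"
    using u by (auto simp: basis_mod_def)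
  have "R.independent K (us k)" if "k \<le> n" for k
    using that
  proof (induction k)
    case 0
    then show ?case by (simp add: us_def)
  next
    case (Suc k)
    have "q (u k) \<notin> R.Span K (us k)"
    proof
      assume "q (u k) \<in> R.Span K (us k)"
      then obtain a where a: "u k - (\<Sum>i<k. cst (a i) * u i) \<in> J" unfolding Span by (auto simp: q_eq)
      \<comment> \<open>Membership in the span becomes a relation with coefficient 1 at
        \<open>k\<close>, padded by zeros up to \<open>n\<close>.\<close>
      define b where "b i = (if i < k then - a i else if i = k then 1 else 0)" for i
      have "(\<Sum>i<n. cst (b i) * u i) = (\<Sum>i<Suc k. cst (b i) * u i)"
        using Suc.prems by (intro sum.mono_neutral_right) (auto simp: b_def)
      also have "\<dots> = u k - (\<Sum>i<k. cst (a i) * u i)"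
        by (simp add: b_def single_uminus sum_negf)
      finally have "(\<Sum>i<n. cst (b i) * u i) \<in> J" using a by simp
      then have "b k = 0" using ind Suc.prems unfolding indep_mod_def by simp
      then show False by (simp add: b_def)
    qed
    then have "R.independent K (q (u k) # us k)"
      using Suc by (intro R.li_Cons) (auto simp: q_simps)
    then show ?case by (simp add: us_def)
  qed
  then have "R.dimension (length (us n)) K (R.Span K (us n))"
    by (intro R.dimension_independent) simp
  moreover have "R.Span K (us n) = q ` V"
  proof (intro equalityI subsetI)
    fix x assume "x \<in> R.Span K (us n)"
    then obtain a where x: "x = q (\<Sum>i<n. cst (a i) * u i)" unfolding Span by blast
    have "(\<Sum>i<n. cst (a i) * u i) \<in> V"
      by (rule mv.subspace_sum[OF V]) (simp add: mv.subspace_scale[OF V] uV)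
    then show "x \<in> q ` V" using x by blast
  next
    fix x assume "x \<in> q ` V"
    then obtain f where f: "f \<in> V" "x = q f" by blast
    then obtain a where "f - (\<Sum>i<n. cst (a i) * u i) \<in> J" using span unfolding spans_mod_def by blast
    then show "x \<in> R.Span K (us n)" unfolding Span using f(2) by (auto simp: q_eq)
  qed
  ultimately have "R.dimension n K (q ` V)" by (simp add: us_def)
  from R.dimI[OF K this] show ?thesis
    by (simp add: quot_dim_def over_def K_def R_def S_def q_def)
qed

section \<open>Ideals whose primes have residue field \<open>K\<close>\<close>

text \<open>If \<open>(J : g)\<close> is a prime with residue field \<open>K\<close>, then \<open>J + gS = J + Kg\<close>, so Noetherian
  induction builds the flag from the top.\<close>

lemma exists_flag:
  fixes J0 J :: "('n::finite, 'k::field) mvpoly set"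
  assumes res: "\<And>P f. primeideal P ring_of_type_algebra \<Longrightarrow> J0 \<subseteq> P \<Longrightarrow> \<exists>c. f - cst c \<in> P"
    and J: "ideal J ring_of_type_algebra" "J0 \<subseteq> J"
  shows "\<exists>n u. basis_mod J UNIV n u \<and>
    (\<forall>r\<le>n. \<exists>Q v. ideal Q ring_of_type_algebra \<and> J \<subseteq> Q \<and> basis_mod Q UNIV r v)"
  using J
proof (induction J rule: wf_induct_rule[OF wf_ideal_psupset_mpoly])
  case (1 J)
  note J = "1.prems"
  show ?case
  proof (cases "1 \<in> J")
    case True
    then have UNIV: "J = UNIV" by (rule ideal_one_mem[OF J(1)])
    have "basis_mod J UNIV 0 (\<lambda>_. 0)"
      unfolding UNIV by (simp add: basis_mod_def indep_mod_def spans_mod_def)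
    moreover have "\<forall>r\<le>0. \<exists>Q v. ideal Q ring_of_type_algebra \<and> J \<subseteq> Q \<and> basis_mod Q UNIV r v"
      using calculation J(1) by (intro allI impI exI[of _ J] exI[of _ "\<lambda>_. 0"]) simp
    ultimately show ?thesis by blast
  next
    case False
    \<comment> \<open>For \<open>T = {1}\<close>, disjointness just says that the colon ideal is
      proper.\<close>
    have "{z. z * 1 \<in> J} \<inter> {1} = {}" using False by simp
    then obtain g where "primeideal {z. z * (g * 1) \<in> J} ring_of_type_algebra"
      using exists_prime_colon_disjoint[OF wf_ideal_psupset_mpoly J(1), of "{1}" 1] by auto
    then have P: "primeideal {z. z * g \<in> J} ring_of_type_algebra" by simp
    have "g \<notin> J" using P by (auto simp: primeideal_ring_of_type_algebra_iff)
    have "J0 \<subseteq> {z. z * g \<in> J}" using J(2) ideal_mult_mem'[OF J(1)] by blast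
    note res_P = res[OF P this]
    define J' where "J' = {a + g * y |a y. a \<in> J}"
    have J': "ideal J' ring_of_type_algebra"
      unfolding J'_def by (rule ideal_add_multiples[OF J(1)])
    have "a \<in> J'" if "a \<in> J" for a
      unfolding J'_def using that by (intro CollectI exI[of _ a] exI[of _ 0]) simp
    then have sub: "J \<subseteq> J'" by blast
    have "g \<in> J'"
      unfolding J'_def using ideal_zero_mem[OF J(1)] by (intro CollectI exI[of _ 0] exI[of _ 1]) simp
    then have "J \<subset> J'" using sub \<open>g \<notin> J\<close> by blast
    then have "(J', J) \<in> {(J', J). ideal J ring_of_type_algebra \<and>
        ideal J' ring_of_type_algebra \<and> J \<subset> J'}" using J(1) J' by simp
    from "1.IH"[OF this J'] obtain n u where u: "basis_mod J' UNIV n u"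
      and flag: "\<forall>r\<le>n. \<exists>Q v. ideal Q ring_of_type_algebra \<and> J' \<subseteq> Q \<and> basis_mod Q UNIV r v"
      using J(2) sub by blast
    \<comment> \<open>A basis of \<open>S/J'\<close> together with \<open>g\<close>, which spans
      \<open>J'/J\<close>, is a basis of \<open>S/J\<close>.\<close>
    define w where "w = u(n := g)"
    have w: "(\<Sum>i<Suc n. cst (a i) * w i) = (\<Sum>i<n. cst (a i) * u i) + cst (a n) * g" for a
      by (simp add: w_def)
    have "indep_mod J (Suc n) w"
      unfolding indep_mod_def w
    proof (intro allI impI)
      fix a i assume rel: "(\<Sum>i<n. cst (a i) * u i) + cst (a n) * g \<in> J" and i: "i < Suc n"
      have "(\<Sum>i<n. cst (a i) * u i) + cst (a n) * g - cst (a n) * g \<in> J'"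
        by (rule ideal_diff_mem[OF J' subsetD[OF sub rel] ideal_mult_mem[OF J' \<open>g \<in> J'\<close>]])
      then have "(\<Sum>i<n. cst (a i) * u i) \<in> J'" by simp
      then have a0: "\<forall>i<n. a i = 0" using u unfolding basis_mod_def indep_mod_def by blast
      then have ag: "cst (a n) * g \<in> J" using rel by simp
      have "a n = 0"
      proof (rule ccontr)
        assume "a n \<noteq> 0"
        then have "cst (1 / a n) * (cst (a n) * g) = g" by (simp flip: mult.assoc cst_mult)
        then show False using ideal_mult_mem[OF J(1) ag, of "cst (1 / a n)"] \<open>g \<notin> J\<close> by simp
      qed
      then show "a i = 0" using a0 i less_Suc_eq by auto
    qed
    moreover have "spans_mod J UNIV (Suc n) w"
      unfolding spans_mod_def w
    proof
      fix f
      obtain a where "f - (\<Sum>i<n. cst (a i) * u i) \<in> J'"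
        using u unfolding basis_mod_def spans_mod_def by blast
      then obtain b y where b: "f - (\<Sum>i<n. cst (a i) * u i) = b + g * y" "b \<in> J"
        unfolding J'_def by blast
      \<comment> \<open>Modulo \<open>(J : g)\<close> the cofactor \<open>y\<close> is a constant,
        so \<open>g * y\<close> is a scalar multiple of \<open>g\<close> modulo
        \<open>J\<close>.\<close>
      obtain c where "y - cst c \<in> {z. z * g \<in> J}" using res_P[of y] by blast
      then have "(y - cst c) * g \<in> J" by simp
      then have "b + (y - cst c) * g \<in> J" using b(2) by (intro ideal_add_mem[OF J(1)])
      moreover have "f - (s + z * g) = b + (y - z) * g" if "f - s = b + g * y" for s z
        using that by (simp add: algebra_simps)
      from this[OF b(1)] have "f - ((\<Sum>i<n. cst (a i) * u i) + cst c * g) = b + (y - cst c) * g" .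
      ultimately have "f - ((\<Sum>i<n. cst (a i) * u i) + cst c * g) \<in> J" by simp
      then have "f - ((\<Sum>i<n. cst ((a(n := c)) i) * u i) + cst ((a(n := c)) n) * g) \<in> J" by simp
      then show "\<exists>a. f - ((\<Sum>i<n. cst (a i) * u i) + cst (a n) * g) \<in> J" by blast
    qed
    ultimately have basis: "basis_mod J UNIV (Suc n) w" by (simp add: basis_mod_def)
    moreover have "\<exists>Q v. ideal Q ring_of_type_algebra \<and> J \<subseteq> Q \<and> basis_mod Q UNIV r v"
      if "r \<le> Suc n" for r
    \<comment> \<open>The new member of the flag is \<open>J\<close> itself; the others come from
      the flag of \<open>J'\<close>.\<close>
    proof (cases "r = Suc n")
      case True
      then show ?thesis using basis J(1) by blast
    next
      case False
      then have "r \<le> n" using that by simp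
      then show ?thesis using flag sub by blast
    qed
    ultimately show ?thesis by blast
  qed
qed

section \<open>One-dimensional ideals with linear associated primes\<close>

locale linear_dim_one =
  fixes I :: "('n::finite, 'k::field) mvpoly set" and h :: "('n, 'k) mvpoly"
  assumes ideal: "ideal I ring_of_type_algebra" and proper: "1 \<notin> I" and graded: "graded_ideal I"
    and linear: "\<And>p. p \<in> assoc_primes ring_of_type_algebra I \<Longrightarrow> generated_by_linear_forms p"
    and h: "h \<in> homog_part 1" and h_regular: "\<And>x. x * h \<in> I \<Longrightarrow> x \<in> I"
    and dim: "krull_dim (ring_of_type_algebra Quot I) = 1"
begin

section \<open>Associated primes of \<open>I\<close> as ideals of lines\<close>

abbreviation assoc :: "('n, 'k) mvpoly set \<Rightarrow> bool" where
  "assoc p \<equiv> p \<in> assoc_primes ring_of_type_algebra I"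

lemma assoc_iff: "assoc p \<longleftrightarrow> primeideal p ring_of_type_algebra \<and> (\<exists>x. p = {z. z * x \<in> I})"
  by (simp add: assoc_primes_def colon_ideal_ring_of_type_algebra)

lemma assoc_prime:
  assumes "assoc p"
  shows "primeideal p ring_of_type_algebra" "ideal p ring_of_type_algebra" "1 \<notin> p"
  using assms by (auto simp: assoc_iff primeideal_ring_of_type_algebra_iff)

lemma assoc_witness:
  assumes "assoc p"
  obtains x where "x \<notin> I" "p = {z. z * x \<in> I}"
proof -
  obtain x where x: "p = {z. z * x \<in> I}" using assms by (auto simp: assoc_iff)
  then have "x \<notin> I" using assoc_prime(3)[OF assms] by simp
  then show thesis using x by (rule that)
qed

lemma I_subset_assoc: "assoc p \<Longrightarrow> I \<subseteq> p"
  using ideal_mult_mem'[OF ideal] by (auto simp: assoc_iff)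

lemma h_not_in_assoc:
  assumes "assoc p"
  shows "h \<notin> p"
proof
  obtain x where x: "x \<notin> I" "p = {z. z * x \<in> I}" using assoc_witness[OF assms] .
  assume "h \<in> p"
  then have "x * h \<in> I" using x(2) by (simp add: mult.commute)
  then show False using h_regular x(1) by blast
qed

text \<open>Otherwise a prime would lie strictly between \<open>p\<close> and the irrelevant ideal,
  and \<open>S/I\<close> would have dimension at least 2.\<close>

lemma linear_form_cong:
  assumes p: "assoc p" and l: "l \<in> homog_part 1"
  shows "\<exists>c. l - cst c * h \<in> p"
proof (rule ccontr)
  assume "\<nexists>c. l - cst c * h \<in> p"
  then obtain q where q: "primeideal q ring_of_type_algebra" "p \<subset> q"
    "q \<subset> {f. Poly_Mapping.lookup f 0 = 0}"
    using exists_prime_between[OF linear[OF p] assoc_prime(2)[OF p] h h_not_in_assoc[OF p] l] by blast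
  define P where "P i = (if i = 0 then p else if i = 1 then q else {f. Poly_Mapping.lookup f 0 = 0})"
    for i :: nat
  have "prime_chain ring_of_type_algebra 2 P"
    unfolding prime_chain_def
  proof (intro conjI allI impI)
    fix i :: nat assume "i \<le> 2"
    then show "primeideal (P i) ring_of_type_algebra"
      using assoc_prime(1)[OF p] q(1) primeideal_zero_const_coeff[where 'n = 'n and 'k = 'k]
      by (simp add: P_def)
  next
    fix i :: nat assume "i < 2"
    then show "P i \<subset> P (Suc i)" using q(2,3) by (cases i) (simp_all add: P_def)
  qed
  from krull_dim_quot_ge[OF cring_from_type_algebra ideal this] have "enat 2 \<le> 1"
    using I_subset_assoc[OF p] dim by (simp add: P_def)
  then show False by (simp add: one_enat_def)
qed

text \<open>The ideal \<open>(I, h - 1)\<close>, so that \<open>A\<close> is \<open>S/dehom\<close>;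
  membership directly gives the decomposition that homogenising uses.\<close>

definition dehom :: "('n, 'k) mvpoly set" where
  "dehom = {a + (h - 1) * y |a y. a \<in> I}"

lemma ideal_dehom: "ideal dehom ring_of_type_algebra"
  unfolding dehom_def by (rule ideal_add_multiples[OF ideal])

lemma I_subset_dehom: "I \<subseteq> dehom"
proof
  fix a assume "a \<in> I"
  then show "a \<in> dehom" unfolding dehom_def by (intro CollectI exI[of _ a] exI[of _ 0]) simp
qed

lemma h_minus_1_in_dehom: "h - 1 \<in> dehom"
  unfolding dehom_def using ideal_zero_mem[OF ideal]
  by (intro CollectI exI[of _ 0] exI[of _ 1]) simp

lemma homog_in_dehom: "x \<in> homog_part n \<Longrightarrow> x \<in> dehom \<Longrightarrow> x \<in> I"
  unfolding dehom_def using homog_mem_of_dehomog[OF ideal graded h h_regular] by blast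

section \<open>Prime ideals of \<open>A\<close>\<close>

lemma exists_assoc_in_prime:
  assumes P: "primeideal P ring_of_type_algebra" "I \<subseteq> P"
  obtains p where "assoc p" "p \<subseteq> P"
proof -
  note P' = P(1)[unfolded primeideal_ring_of_type_algebra_iff]
  have "{z. z * 1 \<in> I} \<inter> - P = {}" using P(2) by auto
  moreover have "1 \<in> - P" "\<And>a b. a \<in> - P \<Longrightarrow> b \<in> - P \<Longrightarrow> a * b \<in> - P" using P' by auto
  ultimately obtain y where "primeideal {z. z * (y * 1) \<in> I} ring_of_type_algebra"
    "{z. z * (y * 1) \<in> I} \<inter> - P = {}"
    using exists_prime_colon_disjoint[OF wf_ideal_psupset_mpoly ideal, of "- P" 1] by blast
  then show thesis using that[of "{z. z * (y * 1) \<in> I}"] by (auto simp: assoc_iff)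
qed

text \<open>The polynomial \<open>f\<close> is first replaced by a form modulo \<open>P\<close>,
  since only forms are known to be multiples of a power of \<open>h\<close> modulo
  \<open>p\<close>.\<close>

lemma residue_field:
  assumes P: "primeideal P ring_of_type_algebra" "dehom \<subseteq> P"
  shows "\<exists>c. f - cst c \<in> P"
proof -
  have idP: "ideal P ring_of_type_algebra" using P(1) by (rule primeideal.axioms)
  have h1: "h - 1 \<in> P" using P(2) h_minus_1_in_dehom by blast
  obtain p where p: "assoc p" "p \<subseteq> P"
    using exists_assoc_in_prime[OF P(1)] P(2) I_subset_dehom by blast
  obtain n g where g: "g \<in> homog_part n" "f - g \<in> P"
    using exists_homog_representative[OF idP h1 h, of f] by blast
  obtain c where c: "g - cst c * h ^ n \<in> p"
    using form_cong_power[OF assoc_prime(2)[OF p(1)] linear_form_cong[OF p(1)] g(1)] by blast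
  have "cst c - h ^ n * cst c \<in> P" by (rule sub_power_mult_mem[OF idP h1])
  then have "(f - g) + (g - cst c * h ^ n) - (cst c - h ^ n * cst c) \<in> P"
    by (rule ideal_diff_mem[OF idP ideal_add_mem[OF idP g(2) subsetD[OF p(2) c]]])
  moreover have "(f - g) + (g - x * y) - (x - y * x) = f - x" for x y by (simp add: mult.commute)
  ultimately show ?thesis by auto
qed

text \<open>Transfers membership in a prime of \<open>A\<close> back to zero division on
  \<open>S/I\<close>: a nonzero scalar \<open>c\<close> would lie in \<open>P\<close> and make it
  improper.\<close>

lemma form_in_assoc:
  assumes P: "primeideal P ring_of_type_algebra" "dehom \<subseteq> P"
    and f: "f \<in> homog_part d" "f \<in> P"
  shows "\<exists>p. assoc p \<and> f \<in> p"
proof -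
  have idP: "ideal P ring_of_type_algebra" using P(1) by (rule primeideal.axioms)
  have h1: "h - 1 \<in> P" using P(2) h_minus_1_in_dehom by blast
  obtain p where p: "assoc p" "p \<subseteq> P"
    using exists_assoc_in_prime[OF P(1)] P(2) I_subset_dehom by blast
  obtain c where c: "f - cst c * h ^ d \<in> p"
    using form_cong_power[OF assoc_prime(2)[OF p(1)] linear_form_cong[OF p(1)] f(1)] by blast
  have "c = 0"
  proof (rule ccontr)
    assume "c \<noteq> 0"
    have "cst c - h ^ d * cst c \<in> P" by (rule sub_power_mult_mem[OF idP h1])
    then have "(cst c - h ^ d * cst c) + (f - (f - cst c * h ^ d)) \<in> P"
      by (rule ideal_add_mem[OF idP _ ideal_diff_mem[OF idP f(2) subsetD[OF p(2) c]]])
    then have "cst c \<in> P" by (simp add: mult.commute)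
    then have "cst (1 / c) * cst c \<in> P" by (rule ideal_mult_mem[OF idP])
    then have "1 \<in> P" using \<open>c \<noteq> 0\<close> by (simp flip: cst_mult)
    then show False using P(1) by (simp add: primeideal_ring_of_type_algebra_iff)
  qed
  then show ?thesis using c p(1) by auto
qed

section \<open>Forms of large degree and the degree of \<open>S/(I, f)\<close>\<close>

lemma exists_flag_dehom:
  assumes "ideal J ring_of_type_algebra" "dehom \<subseteq> J"
  shows "\<exists>n u. basis_mod J UNIV n u \<and>
    (\<forall>r\<le>n. \<exists>Q v. ideal Q ring_of_type_algebra \<and> J \<subseteq> Q \<and> basis_mod Q UNIV r v)"
  using exists_flag[of dehom J] residue_field assms by blast

text \<open>The degree from which forms represent \<open>f\<close> depends on \<open>f\<close>;
  since \<open>A\<close> is finite-dimensional, a bound for a basis serves every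
  \<open>f\<close>.\<close>

lemma exists_uniform_representatives:
  obtains N where "\<And>n f. n \<ge> N \<Longrightarrow> \<exists>g\<in>homog_part n. f - g \<in> dehom"
proof -
  obtain e u where u: "basis_mod dehom UNIV e u"
    using exists_flag_dehom[OF ideal_dehom] by blast
  have "\<forall>i. \<exists>N. \<forall>n\<ge>N. \<exists>g\<in>homog_part n. u i - g \<in> dehom"
    using exists_homog_representative[OF ideal_dehom h_minus_1_in_dehom h] by blast
  then obtain N where N: "\<And>i n. n \<ge> N i \<Longrightarrow> \<exists>g\<in>homog_part n. u i - g \<in> dehom" by metis
  \<comment> \<open>The sum of the bounds stands in for their maximum.\<close>
  have "\<exists>g\<in>homog_part n. f - g \<in> dehom" if n: "n \<ge> (\<Sum>i<e. N i)" for n f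
  proof -
    have "N i \<le> n" if "i < e" for i
      using member_le_sum[of i "{..<e}" N] that n by simp
    then have "\<forall>i. \<exists>g. i < e \<longrightarrow> g \<in> homog_part n \<and> u i - g \<in> dehom" using N by blast
    then obtain g where g: "\<And>i. i < e \<Longrightarrow> g i \<in> homog_part n \<and> u i - g i \<in> dehom" by metis
    obtain a where a: "f - (\<Sum>i<e. cst (a i) * u i) \<in> dehom"
      using u unfolding basis_mod_def spans_mod_def by blast
    have "(f - (\<Sum>i<e. cst (a i) * u i)) + (\<Sum>i<e. cst (a i) * (u i - g i)) \<in> dehom"
      using a g by (intro ideal_add_mem[OF ideal_dehom] ideal_sum_mem[OF ideal_dehom]
          ideal_mult_mem[OF ideal_dehom]) auto
    then have "f - (\<Sum>i<e. cst (a i) * g i) \<in> dehom"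
      by (simp add: right_diff_distrib sum_subtractf)
    moreover have "(\<Sum>i<e. cst (a i) * g i) \<in> homog_part n"
      using g by (intro homog_part_sum homog_part_scale) auto
    ultimately show ?thesis by blast
  qed
  then show thesis by (rule that)
qed

text \<open>For large \<open>n\<close> the map \<open>S\<^sub>n \<rightarrow> S/(I, h - 1, f)\<close> is onto and its kernel is the degree \<open>n\<close>
  part of \<open>(I, f)\<close>.\<close>

lemma hilbert_fun_add_multiples:
  assumes f: "f \<in> homog_part d" and proper': "1 \<notin> {a + f * y |a y. a \<in> I}"
    and u: "basis_mod {a + f * y |a y. a \<in> dehom} UNIV c u"
  shows "\<exists>N. \<forall>n\<ge>N. hilbert_fun {a + f * y |a y. a \<in> I} n = c"
proof -
  define J where "J = {a + f * y |a y. a \<in> I}"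
  define Jt where "Jt = {a + f * y |a y. a \<in> dehom}"
  have J: "ideal J ring_of_type_algebra" "ideal Jt ring_of_type_algebra"
    unfolding J_def Jt_def by (rule ideal_add_multiples[OF ideal] ideal_add_multiples[OF ideal_dehom])+
  have sub: "J \<subseteq> Jt" unfolding J_def Jt_def using I_subset_dehom by blast
  have "a \<in> Jt" if "a \<in> dehom" for a
    unfolding Jt_def using that by (intro CollectI exI[of _ a] exI[of _ 0]) simp
  then have dJt: "dehom \<subseteq> Jt" by blast
  obtain N where N: "\<And>n f. n \<ge> N \<Longrightarrow> \<exists>g\<in>homog_part n. f - g \<in> dehom"
    using exists_uniform_representatives by blast
  \<comment> \<open>Representatives are needed in degree \<open>n\<close> and, for the cofactor of
    \<open>f\<close>, in degree \<open>n - d\<close>.\<close>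
  have "hilbert_fun J n = c" if n: "n \<ge> N + d" for n
  proof -
    have meet: "x \<in> J" if x: "x \<in> homog_part n" "x \<in> Jt" for x
    proof -
      \<comment> \<open>The cofactor \<open>y\<close> is traded for a form \<open>z\<close>; then
        \<open>x - f * z\<close> is a form of degree \<open>n\<close> in \<open>dehom\<close>, hence
        in \<open>I\<close>.\<close>
      obtain a y where a: "x = a + f * y" "a \<in> dehom" using x(2) unfolding Jt_def by blast
      have "n - d \<ge> N" using n by simp
      then obtain z where z: "z \<in> homog_part (n - d)" "y - z \<in> dehom" using N by blast
      have "f * z \<in> homog_part n" using homog_part_mult[OF f z(1)] n by simp
      then have hom: "x - f * z \<in> homog_part n" by (rule homog_part_diff[OF x(1)])
      have "x - f * z = a + f * (y - z)" by (simp add: a(1) algebra_simps)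
      also have "\<dots> \<in> dehom"
        by (rule ideal_add_mem[OF ideal_dehom a(2) ideal_mult_mem[OF ideal_dehom z(2)]])
      finally have "x - f * z \<in> I" using homog_in_dehom[OF hom] by blast
      moreover have "x = (x - f * z) + f * z" by simp
      ultimately show ?thesis unfolding J_def by blast
    qed
    have "\<forall>i. \<exists>g. g \<in> homog_part n \<and> u i - g \<in> dehom" using N[of n] n by auto
    then obtain g where g: "\<And>i. g i \<in> homog_part n" "\<And>i. u i - g i \<in> dehom" by metis
    have diff: "(\<Sum>i<c. cst (a i) * u i) - (\<Sum>i<c. cst (a i) * g i) \<in> Jt" for a
    proof -
      have "(\<Sum>i<c. cst (a i) * (u i - g i)) \<in> Jt"
        using g(2) dJt by (intro ideal_sum_mem[OF J(2)] ideal_mult_mem[OF J(2)]) auto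
      then show ?thesis by (simp add: right_diff_distrib sum_subtractf)
    qed
    have "indep_mod J c g"
      unfolding indep_mod_def
    proof (intro allI impI)
      fix a i assume "(\<Sum>i<c. cst (a i) * g i) \<in> J" and i: "i < c"
      then have "((\<Sum>i<c. cst (a i) * u i) - (\<Sum>i<c. cst (a i) * g i)) + (\<Sum>i<c. cst (a i) * g i) \<in> Jt"
        using sub by (intro ideal_add_mem[OF J(2) diff]) auto
      then have "(\<Sum>i<c. cst (a i) * u i) \<in> Jt" by simp
      then show "a i = 0"
        using u i unfolding Jt_def[symmetric] basis_mod_def indep_mod_def by blast
    qed
    moreover have "spans_mod J (homog_part n) c g"
      unfolding spans_mod_def
    proof
      fix x :: "('n, 'k) mvpoly" assume x: "x \<in> homog_part n"
      obtain a where "x - (\<Sum>i<c. cst (a i) * u i) \<in> Jt"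
        using u unfolding Jt_def[symmetric] basis_mod_def spans_mod_def by blast
      then have "(x - (\<Sum>i<c. cst (a i) * u i)) + ((\<Sum>i<c. cst (a i) * u i) - (\<Sum>i<c. cst (a i) * g i)) \<in> Jt"
        by (rule ideal_add_mem[OF J(2) _ diff])
      then have "x - (\<Sum>i<c. cst (a i) * g i) \<in> Jt" by simp
      moreover have "x - (\<Sum>i<c. cst (a i) * g i) \<in> homog_part n"
        using g(1) by (intro homog_part_diff[OF x] homog_part_sum homog_part_scale)
      ultimately show "\<exists>a. x - (\<Sum>i<c. cst (a i) * g i) \<in> J" using meet by blast
    qed
    ultimately have "basis_mod J (homog_part n) c g" using g(1) by (simp add: basis_mod_def)
    moreover have "ideal J mpoly_ring" using J(1) by (simp add: mpoly_ring_def)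
    moreover have "1 \<notin> J" using proper' by (simp add: J_def)
    ultimately show ?thesis
      unfolding hilbert_fun_def using quot_dim_eq subspace_homog_part by blast
  qed
  then show ?thesis unfolding J_def by blast
qed

text \<open>The chain from \<open>p\<close> to the irrelevant ideal keeps the dimension of
  \<open>S/(I, f)\<close> at 1. Factorial and power in the degree are then 1, and the limit is that
  of an eventually constant Hilbert function.\<close>

lemma deg_quot_add_multiples:
  assumes f: "f \<in> homog_part d" "f \<in> p" and p: "assoc p"
    and u: "basis_mod {a + f * y |a y. a \<in> dehom} UNIV c u"
  shows "deg_quot {a + f * y |a y. a \<in> I} = real c"
proof -
  define J where "J = {a + f * y |a y. a \<in> I}"
  have J: "ideal J ring_of_type_algebra" unfolding J_def by (rule ideal_add_multiples[OF ideal])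
  have Jp: "J \<subseteq> p" unfolding J_def using I_subset_assoc[OF p] f(2) assoc_prime(2)[OF p]
    by (auto intro: ideal_add_mem ideal_mult_mem')
  then have "1 \<notin> J" using assoc_prime(3)[OF p] by blast
  then obtain N where N: "\<And>n. n \<ge> N \<Longrightarrow> hilbert_fun J n = c"
    using hilbert_fun_add_multiples[OF f(1) _ u] unfolding J_def by blast
  have "a \<in> J" if "a \<in> I" for a
    unfolding J_def using that by (intro CollectI exI[of _ a] exI[of _ 0]) simp
  then have "I \<subseteq> J" by blast
  from krull_dim_quot_antimono[OF cring_from_type_algebra ideal J this]
  have "krull_dim (ring_of_type_algebra Quot J) \<le> 1" using dim by simp
  moreover define P where "P i = (if i = 0 then p else {f. Poly_Mapping.lookup f 0 = 0})" for i :: nat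
  have "p \<subset> {f. Poly_Mapping.lookup f 0 = 0}"
    by (rule linear_ideal_psubset_irrelevant[OF linear[OF p] h h_not_in_assoc[OF p]])
  then have "prime_chain ring_of_type_algebra 1 P"
    unfolding prime_chain_def P_def using assoc_prime(1)[OF p] primeideal_zero_const_coeff by auto
  from krull_dim_quot_ge[OF cring_from_type_algebra J this]
  have "enat 1 \<le> krull_dim (ring_of_type_algebra Quot J)" using Jp by (simp add: P_def)
  ultimately have "krull_dim (ring_of_type_algebra Quot J) = 1" by (simp add: one_enat_def)
  then have k: "the_enat (krull_dim (mpoly_ring Quot J)) = 1" by (simp add: mpoly_ring_def one_enat_def)
  have "(\<lambda>n. real (hilbert_fun J n)) \<longlonglongrightarrow> real c"
    by (rule tendsto_eventually) (use N eventually_sequentially in auto)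
  then have "lim (\<lambda>n. real (hilbert_fun J n)) = real c" by (rule limI)
  then show ?thesis unfolding J_def[symmetric] by (simp add: deg_quot_def k)
qed

section \<open>Zero divisors and the final estimate\<close>

lemma zero_div_form_in_assoc:
  assumes "f \<in> zero_div_forms I d"
  obtains p where "assoc p" "f \<in> p"
proof -
  have "{x. x * f \<in> I} \<noteq> I"
    using assms by (simp add: zero_div_forms_def mpoly_ring_def colon_ideal_ring_of_type_algebra)
  then obtain x where x: "x * f \<in> I" "x \<notin> I" using ideal_mult_mem'[OF ideal] by blast
  \<comment> \<open>Some associated prime contains \<open>(I : x)\<close>, and \<open>f\<close> lies
    in \<open>(I : x)\<close>.\<close>
  have "{z. z * x \<in> I} \<inter> {1} = {}" using x(2) by simp
  then obtain y where "primeideal {z. z * (y * x) \<in> I} ring_of_type_algebra"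
    using exists_prime_colon_disjoint[OF wf_ideal_psupset_mpoly ideal, of "{1}" x] by auto
  then have "assoc {z. z * (y * x) \<in> I}" by (auto simp: assoc_iff)
  moreover have "y * (x * f) \<in> I" by (rule ideal_mult_mem[OF ideal x(1)])
  then have "f \<in> {z. z * (y * x) \<in> I}" by (simp add: ac_simps)
  ultimately show thesis by (rule that)
qed

lemma zero_div_formI:
  assumes "f \<in> homog_part d" "f \<notin> I" "assoc p" "f \<in> p"
  shows "f \<in> zero_div_forms I d"
proof -
  obtain x where "x \<notin> I" "p = {z. z * x \<in> I}" using assoc_witness[OF assms(3)] .
  then have "x \<in> {x. x * f \<in> I}" "x \<notin> I" using assms(4) by (simp_all add: mult.commute)
  then have "{x. x * f \<in> I} \<noteq> I" by blast
  then show ?thesis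
    using assms(1,2) by (simp add: zero_div_forms_def mpoly_ring_def colon_ideal_ring_of_type_algebra)
qed

lemma hilbert_fun_le_hyp_fun: "real (hilbert_fun I d) - 1 \<le> hyp_fun I d"
proof -
  define D where "D f = deg_quot (Idl\<^bsub>mpoly_ring\<^esub> (I \<union> {f}))" for f
  have D: "D f = deg_quot {a + f * y |a y. a \<in> I}" for f
    by (simp add: D_def mpoly_ring_def genideal_insert[OF ideal, simplified])
  define Jt where "Jt f = {a + f * y |a y. a \<in> dehom}" for f
  have Jt: "ideal (Jt f) ring_of_type_algebra" for f
    unfolding Jt_def by (rule ideal_add_multiples[OF ideal_dehom])
  have "a \<in> Jt f" if "a \<in> dehom" for a f
    unfolding Jt_def using that by (intro CollectI exI[of _ a] exI[of _ 0]) simp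
  then have dJt: "dehom \<subseteq> Jt f" for f by blast
  obtain e u where u: "basis_mod dehom UNIV e u"
    and flag: "\<And>r. r \<le> e \<Longrightarrow> \<exists>Q v. ideal Q ring_of_type_algebra \<and> dehom \<subseteq> Q \<and> basis_mod Q UNIV r v"
    using exists_flag_dehom[OF ideal_dehom] by blast
  have deg: "\<exists>c v. basis_mod (Jt f) UNIV c v \<and> D f = real c \<and> c \<le> e"
    if f: "f \<in> zero_div_forms I d" for f
  proof -
    obtain c v where v: "basis_mod (Jt f) UNIV c v" using exists_flag_dehom[OF Jt dJt] by blast
    obtain p where p: "assoc p" "f \<in> p" using zero_div_form_in_assoc[OF f] .
    have "f \<in> homog_part d" using f by (simp add: zero_div_forms_def)
    then have "D f = real c" unfolding D
      using deg_quot_add_multiples[OF _ p(2,1)] v unfolding Jt_def by blast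
    moreover have "c \<le> e"
      using indep_mod_le_spans_mod[OF subspace_ideal[OF Jt] dJt, of c v UNIV f e u] u v
      by (simp add: basis_mod_def)
    ultimately show ?thesis using v by blast
  qed
  \<comment> \<open>The degrees are naturals up to \<open>e\<close>, the dimension of
    \<open>A\<close>, so \<open>Max\<close> in \<open>hyp_fun\<close> is a true maximum.\<close>
  have "D ` zero_div_forms I d \<subseteq> real ` {..e}" using deg by fastforce
  then have fin: "finite (D ` zero_div_forms I d)" by (rule finite_subset) simp
  have hyp: "D f \<le> hyp_fun I d" if "f \<in> zero_div_forms I d" for f
    using that fin by (auto simp: hyp_fun_def D_def[abs_def])
  show ?thesis
  proof (cases "hilbert_fun I d \<le> 1")
    case True
    \<comment> \<open>This suffices as the left side is at most 0. Without zero divisor forms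
      \<open>hyp_fun\<close> is 0 by definition; otherwise it bounds a natural number from
      above.\<close>
    have "0 \<le> hyp_fun I d"
    proof (cases "zero_div_forms I d = {}")
      case False
      then obtain f where f: "f \<in> zero_div_forms I d" by blast
      from hyp[OF f] deg[OF f] show ?thesis by auto
    qed (simp add: hyp_fun_def)
    then show ?thesis using True by simp
  next
    case False
    have "spans_mod dehom (homog_part d) e u"
      using u by (auto simp: basis_mod_def spans_mod_def)
    then obtain n v where n: "n \<le> e" and v: "basis_mod dehom (homog_part d) n v"
      using exists_basis_mod[OF subspace_ideal[OF ideal_dehom]] by blast
    have vd: "v i \<in> homog_part d" if "i < n" for i using v that by (simp add: basis_mod_def)
    have sum_v: "(\<Sum>i<n. cst (a i) * v i) \<in> homog_part d" for a
      using vd by (intro homog_part_sum homog_part_scale) simp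
    \<comment> \<open>A basis of the image of \<open>S_d\<close> in \<open>A\<close> is also a basis
      modulo \<open>I\<close>, since forms in \<open>dehom\<close> lie in \<open>I\<close>; hence
      \<open>n\<close> is the Hilbert function at \<open>d\<close>.\<close>
    have "spans_mod I (homog_part d) n v"
      unfolding spans_mod_def
    proof
      fix x :: "('n, 'k) mvpoly" assume x: "x \<in> homog_part d"
      then obtain a where "x - (\<Sum>i<n. cst (a i) * v i) \<in> dehom"
        using v unfolding basis_mod_def spans_mod_def by blast
      then have "x - (\<Sum>i<n. cst (a i) * v i) \<in> I"
        by (rule homog_in_dehom[OF homog_part_diff[OF x sum_v]])
      then show "\<exists>a. x - (\<Sum>i<n. cst (a i) * v i) \<in> I" by blast
    qed
    moreover have indep: "indep_mod I n v"
      using v I_subset_dehom unfolding basis_mod_def indep_mod_def by blast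
    ultimately have "basis_mod I (homog_part d) n v" using vd by (simp add: basis_mod_def)
    then have H: "hilbert_fun I d = n"
      unfolding hilbert_fun_def
      using quot_dim_eq[OF _ proper subspace_homog_part] ideal by (simp add: mpoly_ring_def)
    have "n - 1 \<le> e" using n by simp
    from flag[OF this] obtain Q w where Q: "ideal Q ring_of_type_algebra" "dehom \<subseteq> Q" and w: "basis_mod Q UNIV (n - 1) w"
      by blast
    have "\<exists>a. v x - (\<Sum>j<n - 1. cst (a j) * w j) \<in> Q" for x
      using w by (simp add: basis_mod_def spans_mod_def)
    \<comment> \<open>There are \<open>n\<close> forms but only \<open>n - 1\<close> spanning
      vectors modulo \<open>Q\<close>; \<open>n\<close> is at least 2 in this case, so the
      subtraction is not truncated.\<close>
    moreover have "n - 1 < card {..<n}" using False H by simp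
    ultimately have "\<exists>c. (\<exists>x\<in>{..<n}. c x \<noteq> 0) \<and> (\<Sum>x<n. cst (c x) * v x) \<in> Q"
      by (intro exists_relation_mod[OF finite_lessThan subspace_ideal[OF Q(1)]])
    then obtain c where c: "\<exists>x\<in>{..<n}. c x \<noteq> 0" "(\<Sum>x<n. cst (c x) * v x) \<in> Q"
      by blast
    define f where "f = (\<Sum>x<n. cst (c x) * v x)"
    have fd: "f \<in> homog_part d" unfolding f_def by (rule sum_v)
    have fQ: "f \<in> Q" using c(2) by (simp add: f_def)
    have fI: "f \<notin> I"
    proof
      assume "f \<in> I"
      then have "\<forall>i<n. c i = 0"
        using indep unfolding f_def indep_mod_def by (elim allE[of _ c] impE)
      then show False using c(1) by simp
    qed
    \<comment> \<open>The codimension \<open>n - 1\<close> of \<open>Q\<close> is positive.\<close>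
    have "1 \<notin> Q"
    proof
      assume "1 \<in> Q"
      then have "Q = UNIV" by (rule ideal_one_mem[OF Q(1)])
      then have "(\<Sum>i<n - 1. cst 1 * w i) \<in> Q" by simp
      moreover have "indep_mod Q (n - 1) w" using w by (simp add: basis_mod_def)
      ultimately have "\<forall>i<n - 1. (1 :: 'k) = 0"
        unfolding indep_mod_def by (elim allE[of _ "\<lambda>_. 1"] impE)
      moreover have "0 < n - 1" using False H by simp
      ultimately show False by auto
    qed
    then have "{z. z * 1 \<in> Q} \<inter> {1} = {}" by simp
    \<comment> \<open>A prime above \<open>Q\<close> contains both \<open>f\<close> and
      \<open>dehom\<close>, as \<open>form_in_assoc\<close> requires.\<close>
    then obtain y where P: "primeideal {z. z * (y * 1) \<in> Q} ring_of_type_algebra"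
      using exists_prime_colon_disjoint[OF wf_ideal_psupset_mpoly Q(1), of "{1}" 1] by auto
    have QP: "Q \<subseteq> {z. z * (y * 1) \<in> Q}" using ideal_mult_mem'[OF Q(1)] by blast
    then have "\<exists>p. assoc p \<and> f \<in> p"
      using Q(2) fQ by (intro form_in_assoc[OF P _ fd]) blast+
    then obtain p where p: "assoc p" "f \<in> p" by blast
    have fz: "f \<in> zero_div_forms I d" by (rule zero_div_formI[OF fd fI p])
    obtain b v' where b: "basis_mod (Jt f) UNIV b v'" "D f = real b" using deg[OF fz] by blast
    have "Jt f \<subseteq> Q"
    proof
      fix x assume "x \<in> Jt f"
      then obtain a y where x: "x = a + f * y" "a \<in> dehom" unfolding Jt_def by blast
      show "x \<in> Q"
        unfolding x(1)
        by (rule ideal_add_mem[OF Q(1) subsetD[OF Q(2) x(2)] ideal_mult_mem'[OF Q(1) fQ]])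
    qed
    \<comment> \<open>\<open>S/Q\<close> has dimension \<open>n - 1\<close> and is a quotient of
      \<open>S/Jt f\<close>, whose dimension \<open>b\<close> is the degree of
      \<open>S/(I, f)\<close>.\<close>
    then have "n - 1 \<le> b"
      using indep_mod_le_spans_mod[OF subspace_ideal[OF Q(1)], of "Jt f" "n - 1" w UNIV b v'] w b(1)
      by (simp add: basis_mod_def)
    then show ?thesis using hyp[OF fz] b(2) H False by simp
  qed
qed

end

theorem theorem4p19:
  fixes I :: "('n::finite, 'k::field) mvpoly set"
  assumes "I \<noteq> {0}"
    and "unmixed mpoly_ring I"
    and "graded_ideal I"
    and "\<forall>p\<in>assoc_primes mpoly_ring I. generated_by_linear_forms p"
    and "\<exists>h\<in>homog_part 1. regular_on_quotient mpoly_ring I h"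
    and "krull_dim (mpoly_ring Quot I) = 1"
  shows "(\<forall>d\<ge>1. min_dist_fun I d \<le> deg_quot I - real (hilbert_fun I d) + 1) \<and>
         (\<forall>d\<ge>1. real (hilbert_fun I d) - 1 \<le> hyp_fun I d)"
proof -
  obtain h where h: "h \<in> homog_part 1" "regular_on_quotient mpoly_ring I h" using assms(5) by blast
  have ideal: "ideal I ring_of_type_algebra" and "I \<noteq> UNIV"
    using assms(2) by (auto simp: unmixed_def mpoly_ring_def)
  have "{x. x * h \<in> I} = I"
    using h(2) by (simp add: regular_on_quotient_def mpoly_ring_def colon_ideal_ring_of_type_algebra)
  then have regular: "\<And>x. x * h \<in> I \<Longrightarrow> x \<in> I" by blast
  have "1 \<notin> I" using ideal_one_mem[OF ideal] \<open>I \<noteq> UNIV\<close> by blast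
  interpret linear_dim_one I h
  proof (rule linear_dim_one.intro[OF ideal \<open>1 \<notin> I\<close> assms(3) _ h(1) regular])
    show "generated_by_linear_forms p" if "p \<in> assoc_primes ring_of_type_algebra I" for p
      using assms(4) that by (simp add: mpoly_ring_def)
    show "krull_dim (ring_of_type_algebra Quot I) = 1" using assms(6) by (simp add: mpoly_ring_def)
  qed
  \<comment> \<open>Unfolding the minimum distance as degree minus \<open>hyp_fun\<close> turns one
    inequality into the other.\<close>
  have "min_dist_fun I d \<le> deg_quot I - real (hilbert_fun I d) + 1" for d
    using hilbert_fun_le_hyp_fun[of d] by (simp add: min_dist_fun_def)
  then show ?thesis using hilbert_fun_le_hyp_fun by simp
qed

end
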